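(* Consider the Gaussian interference channel with two transmitter-receiver pairs (indexed by $0,1$), gains $g_{jl}\in\mathbb{C}$ and power constraint $Q>0$. The capacity region of this channel with ptp-capacity-achieving codes is contained in $\mathcal C=\mathcal C_0\cap\mathcal C_1$, where for $j\in\{0,1\}$ and $i=1-j$, with $P_{jl}=|g_{jl}|^2Q$, $\mathcal C_j$ is the set of $(R_0,R_1)\in\mathbb{R}_{\ge0}^2$ such that either $$R_j\le C\!\left(\frac{P_{jj}}{1+P_{ji}}\right),$$ or $$R_j\le C(P_{jj}),\quad R_i\le C(P_{ji}),\quad R_0+R_1\le C(P_{jj}+P_{ji}).$$
   Context: $C(x)=\log_2(1+x)$. $\mathcal{CN}(0,1)$ is the circularly symmetric complex Gaussian law with variance $1$. Channel: at each time receiver $j\in\{0,1\}$ observes $Y_j=g_{j0}X_0+g_{j1}X_1+Z_j$ with $Z_j\sim\mathcal{CN}(0,1)$ i.i.d. over time, independent of the messages. Transmitter $j$ sends an independent message $M_j$ uniform on $\{1,\dots,2^{nR_j}\}$ ($2^{nR_j}$ rounded up to an integer) to receiver $j$, which forms an estimate $\hat M_j$ from $Y_j^n$, knowing both codebooks. Codes: an $(n,2^{nR})$ (deterministic) single-user code is a set of codewords $x^n(m)\in\mathbb{C}^n$, $m\in\{1,\dots,2^{nR}\}$, satisfying the power constraint $\frac1n\sum_{i=1}^n|x_i(m)|^2\le Q$. A sequence (in $n$) of such codes achieves rate $R$ over the point-to-point Gaussian channel $Y=gX+Z$, $Z\sim\mathcal{CN}(0,1)$, if with suitable decoders the probability of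 decoding error (uniform message) tends to $0$ as $n\to\infty$. The capacity of this channel is $C(|g|^2Q)$. The code sequence is ptp-capacity-achieving if it achieves rate $R$ over every point-to-point Gaussian channel $Y=gX+Z$ with capacity greater than $R$. A rate pair $(R_0,R_1)$ is achievable over the interference channel via ptp-capacity-achieving codes if there is for each transmitter $j$ a ptp-capacity-achieving sequence of $(n,2^{nR_j})$ codes, and decoders at the receivers, such that $p_n=\frac12\left(P\{\hat M_0\ne M_0\}+P\{\hat M_1\ne M_1\}\right)\to0$ as $n\to\infty$. The capacity region with ptp-capacity-achieving codes is the closure of the set of such achievable rate pairs. *)

theory Defs
  imports "HOL-Probability.Probability"
begin

text \<open>
  The users \<open>0\<close>, \<open>1\<close> are the two elements of the numeral type \<open>2\<close>, in which
  \<open>1 - j\<close> is the other user.  A gain matrix \<open>g\<close> has entries \<open>g $ j $ l\<close>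
  (receiver \<open>j\<close>, transmitter \<open>l\<close>).  A vector in \<open>\<complex>\<^sup>n\<close> is a function on
  \<open>{..<n}\<close>, and a code sequence \<open>c\<close> has symbols \<open>c n m i\<close> (block length \<open>n\<close>,
  message \<open>m\<close>, time \<open>i < n\<close>).
\<close>

definition Cap :: "real \<Rightarrow> real" where
  "Cap x = log 2 (1 + x)"

text \<open>Circularly symmetric with variance 1: independent real and imaginary parts of variance \<open>1/2\<close>.\<close>

definition complex_normal :: "complex measure" where
  "complex_normal =
     distr (density lborel (normal_density 0 (sqrt (1 / 2))) \<Otimes>\<^sub>M
            density lborel (normal_density 0 (sqrt (1 / 2))))
           borel (\<lambda>(u, v). Complex u v)"

definition noise :: "nat \<Rightarrow> (nat \<Rightarrow> complex) measure" where
  "noise n = (\<Pi>\<^sub>M i\<in>{..<n}. complex_normal)"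

definition messages :: "nat \<Rightarrow> real \<Rightarrow> nat set" where
  "messages n R = {1..nat \<lceil>2 powr (real n * R)\<rceil>}"

definition is_code :: "real \<Rightarrow> nat \<Rightarrow> real \<Rightarrow> (nat \<Rightarrow> nat \<Rightarrow> complex) \<Rightarrow> bool" where
  "is_code Q n R c \<longleftrightarrow>
     (\<forall>m\<in>messages n R. (1 / real n) * (\<Sum>i<n. (cmod (c m i))\<^sup>2) \<le> Q)"

definition decoders :: "nat \<Rightarrow> real \<Rightarrow> ((nat \<Rightarrow> complex) \<Rightarrow> nat) set" where
  "decoders n R = (\<Pi>\<^sub>M i\<in>{..<n}. (borel :: complex measure)) \<rightarrow>\<^sub>M count_space (messages n R)"

definition ptp_error ::
  "complex \<Rightarrow> nat \<Rightarrow> real \<Rightarrow> (nat \<Rightarrow> nat \<Rightarrow> complex) \<Rightarrow> ((nat \<Rightarrow> complex) \<Rightarrow> nat) \<Rightarrow> real" where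
  "ptp_error g n R c d =
     (let S = uniform_count_measure (messages n R) \<Otimes>\<^sub>M noise n
      in measure S {(m, z) \<in> space S. d (\<lambda>i\<in>{..<n}. g * c m i + z i) \<noteq> m})"

definition achieves_over_ptp ::
  "complex \<Rightarrow> real \<Rightarrow> (nat \<Rightarrow> nat \<Rightarrow> nat \<Rightarrow> complex) \<Rightarrow> bool" where
  "achieves_over_ptp g R c \<longleftrightarrow>
     (\<exists>d. (\<forall>n. d n \<in> decoders n R) \<and> (\<lambda>n. ptp_error g n R (c n) (d n)) \<longlonglongrightarrow> 0)"

definition ptp_capacity :: "real \<Rightarrow> complex \<Rightarrow> real" where
  "ptp_capacity Q g = Cap ((cmod g)\<^sup>2 * Q)"

definition ptp_capacity_achieving ::
  "real \<Rightarrow> real \<Rightarrow> (nat \<Rightarrow> nat \<Rightarrow> nat \<Rightarrow> complex) \<Rightarrow> bool" where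
  "ptp_capacity_achieving Q R c \<longleftrightarrow>
     (\<forall>n. is_code Q n R (c n)) \<and>
     (\<forall>g. ptp_capacity Q g > R \<longrightarrow> achieves_over_ptp g R c)"

text \<open>
  The error probability of receiver \<open>j\<close> involves only its own noise, so no joint law of the
  noises at the two receivers has to be fixed.
\<close>

definition ic_error ::
  "complex ^ 2 ^ 2 \<Rightarrow> nat \<Rightarrow> real ^ 2 \<Rightarrow> (2 \<Rightarrow> nat \<Rightarrow> nat \<Rightarrow> complex) \<Rightarrow> 2 \<Rightarrow>
   ((nat \<Rightarrow> complex) \<Rightarrow> nat) \<Rightarrow> real" where
  "ic_error g n R c j d =
     (let S = (\<Pi>\<^sub>M l\<in>UNIV. uniform_count_measure (messages n (R $ l))) \<Otimes>\<^sub>M noise n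
      in measure S {(m, z) \<in> space S.
           d (\<lambda>i\<in>{..<n}. g $ j $ 0 * c 0 (m 0) i + g $ j $ 1 * c 1 (m 1) i + z i) \<noteq> m j})"

definition achievable_ptp_codes :: "real \<Rightarrow> complex ^ 2 ^ 2 \<Rightarrow> real ^ 2 \<Rightarrow> bool" where
  "achievable_ptp_codes Q g R \<longleftrightarrow>
     (\<forall>j. R $ j \<ge> 0) \<and>
     (\<exists>c d. (\<forall>j. ptp_capacity_achieving Q (R $ j) (c j)) \<and>
            (\<forall>j n. d j n \<in> decoders n (R $ j)) \<and>
            (\<lambda>n. (1 / 2) * (ic_error g n R (\<lambda>l. c l n) 0 (d 0 n) +
                            ic_error g n R (\<lambda>l. c l n) 1 (d 1 n))) \<longlonglongrightarrow> 0)"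

definition capacity_region_ptp_codes :: "real \<Rightarrow> complex ^ 2 ^ 2 \<Rightarrow> (real ^ 2) set" where
  "capacity_region_ptp_codes Q g = closure {R. achievable_ptp_codes Q g R}"

definition received_power :: "real \<Rightarrow> complex ^ 2 ^ 2 \<Rightarrow> 2 \<Rightarrow> 2 \<Rightarrow> real" where
  "received_power Q g j l = (cmod (g $ j $ l))\<^sup>2 * Q"

definition receiver_region :: "real \<Rightarrow> complex ^ 2 ^ 2 \<Rightarrow> 2 \<Rightarrow> (real ^ 2) set" where
  "receiver_region Q g j =
     (let i = 1 - j; P = received_power Q g in
      {R. (\<forall>l. R $ l \<ge> 0) \<and>
          (R $ j \<le> Cap (P j j / (1 + P j i)) \<or>
           (R $ j \<le> Cap (P j j) \<and> R $ i \<le> Cap (P j i) \<and>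
            R $ 0 + R $ 1 \<le> Cap (P j j + P j i)))})"

end

theory Submission
  imports Defs
begin

text \<open>
  The proof is a single change of measure.  Suppose \<open>R\<^sub>i < C(S)\<close> for some \<open>S = |h|\<^sup>2 Q\<close> above the
  interference power \<open>I = P\<^sub>j\<^sub>i\<close>.  The code of user \<open>i\<close> is then decodable from
  \<open>V = h X\<^sub>i + Z\<close>, of which \<open>g\<^sub>j\<^sub>i X\<^sub>i + Z\<^sub>j\<close> is a degraded version.  Couple \<open>V\<close> with the output \<open>Y\<^sub>j\<close>
  accordingly and compare their joint law with the law under which \<open>Y\<^sub>j\<close> is Gaussian of full
  power and \<open>V\<close> given \<open>Y\<^sub>j\<close> is drawn from the Gaussian posterior.  Under that law both messages
  are decoded correctly with probability at most one over the number of message pairs, while by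
  Bayes' rule the likelihood ratio is a quotient of Gaussian densities, with expected logarithm at most
  \<open>n (ln (1 + S) + ln ((1 + P\<^sub>j\<^sub>j + I) / (1 + I)))\<close>.  Hence \<open>R\<^sub>0 + R\<^sub>1 \<le> C(S) + C(P\<^sub>j\<^sub>j / (1 + I))\<close>.
  Letting \<open>C(S)\<close> decrease to \<open>max R\<^sub>i (C(I))\<close> gives treating interference as noise if \<open>R\<^sub>i \<ge> C(I)\<close> and
  the multiple access bound otherwise.
\<close>

subsection \<open>Complex Gaussian densities\<close>

definition cn_density :: "real \<Rightarrow> complex \<Rightarrow> real" where
  "cn_density s z = exp (- (cmod z)\<^sup>2 / s) / (pi * s)"

lemma measurable_Complex [measurable]:
  "(\<lambda>(u, v). Complex u v) \<in> borel \<Otimes>\<^sub>M borel \<rightarrow>\<^sub>M borel"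
proof -
  have "(\<lambda>(u, v). Complex u v) = (\<lambda>p. of_real (fst p) + \<i> * of_real (snd p))"
    by (auto simp: complex_eq_iff)
  then show ?thesis by simp
qed

text \<open>Lebesgue measure is determined by its values on open boxes, and the preimage of a box
  under \<open>Complex\<close> is a product of two real intervals.\<close>

lemma distr_Complex_lborel:
  "distr (lborel \<Otimes>\<^sub>M lborel) borel (\<lambda>(u, v). Complex u v) = lborel"
proof (rule lborel_eqI[symmetric])
  fix l u :: complex
  assume le: "\<And>b. b \<in> Basis \<Longrightarrow> l \<bullet> b \<le> u \<bullet> b"
  have le': "Re l \<le> Re u" "Im l \<le> Im u"
    using le[of 1] le[of \<i>] by (auto simp: Basis_complex_def inner_complex_def)
  have "(\<lambda>(u, v). Complex u v) -` box l u \<inter> space (lborel \<Otimes>\<^sub>M lborel) =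
      {Re l<..<Re u} \<times> {Im l<..<Im u}"
    by (auto simp: space_pair_measure box_def Basis_complex_def inner_complex_def)
  then show "emeasure (distr (lborel \<Otimes>\<^sub>M lborel) borel (\<lambda>(u, v). Complex u v)) (box l u) =
      ennreal (\<Prod>b\<in>Basis. (u - l) \<bullet> b)"
    using le'
    by (subst emeasure_distr)
      (auto simp: lborel.emeasure_pair_measure_Times Basis_complex_def inner_complex_def
        ennreal_mult measurable_lborel1)
qed simp

lemma nn_integral_lborel_complex:
  assumes [measurable]: "f \<in> borel_measurable (borel :: complex measure)"
  shows "(\<integral>\<^sup>+ z. f z \<partial>lborel) = (\<integral>\<^sup>+ u. \<integral>\<^sup>+ v. f (Complex u v) \<partial>lborel \<partial>lborel)"
proof -
  have "(\<integral>\<^sup>+ z. f z \<partial>lborel) =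
      (\<integral>\<^sup>+ p. f (case p of (u, v) \<Rightarrow> Complex u v) \<partial>(lborel \<Otimes>\<^sub>M lborel))"
    by (subst distr_Complex_lborel[symmetric], subst nn_integral_distr) auto
  also have "\<dots> = (\<integral>\<^sup>+ u. \<integral>\<^sup>+ v. f (Complex u v) \<partial>lborel \<partial>lborel)"
    by (subst lborel.nn_integral_fst[symmetric]) (auto simp: split_def)
  finally show ?thesis .
qed

text \<open>Variance \<open>s\<close> splits into \<open>s / 2\<close> for each real coordinate.
  Through this factorisation complex Gaussian integrals reduce to real ones.\<close>

lemma cn_density_Complex:
  assumes "0 < s"
  shows "cn_density s (Complex u v - m) =
    normal_density (Re m) (sqrt (s / 2)) u * normal_density (Im m) (sqrt (s / 2)) v"
  using assms
  by (simp add: cn_density_def normal_density_def cmod_power2 exp_add[symmetric]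
      add_divide_distrib diff_divide_distrib)

lemma cn_density_pos: "0 < s \<Longrightarrow> 0 < cn_density s z"
  by (simp add: cn_density_def)

lemma measurable_cn_density [measurable]: "cn_density s \<in> borel_measurable borel"
  unfolding cn_density_def by measurable

lemma nn_integral_normal_density:
  "0 < \<sigma> \<Longrightarrow> (\<integral>\<^sup>+ x. normal_density \<mu> \<sigma> x \<partial>lborel) = 1"
  by (subst nn_integral_eq_integral) auto

lemma nn_integral_cn_density:
  assumes "0 < s"
  shows "(\<integral>\<^sup>+ z. cn_density s (z - m) \<partial>lborel) = 1"
  using assms
  by (subst nn_integral_lborel_complex)
    (auto simp: cn_density_Complex ennreal_mult nn_integral_cmult nn_integral_multc nn_integral_normal_density)

lemma nn_integral_normal_density_sq:
  assumes "0 < \<sigma>"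
  shows "(\<integral>\<^sup>+ x. normal_density \<mu> \<sigma> x * (x - c)\<^sup>2 \<partial>lborel) = ennreal (\<sigma>\<^sup>2 + (\<mu> - c)\<^sup>2)"
proof -
  have 0: "has_bochner_integral lborel (normal_density \<mu> \<sigma>) 1"
    using assms by (simp add: has_bochner_integral_iff)
  have 1: "has_bochner_integral lborel (\<lambda>x. normal_density \<mu> \<sigma> x * (x - \<mu>)) 0"
    using normal_moment_odd[OF assms, of \<mu> 0] by simp
  have 2: "has_bochner_integral lborel (\<lambda>x. normal_density \<mu> \<sigma> x * (x - \<mu>)\<^sup>2) (\<sigma>\<^sup>2)"
    using normal_moment_even[OF assms, of \<mu> 1] by (simp add: fact_numeral)
  \<comment> \<open>Expansion of \<open>x - c\<close> around the mean:
    \<open>(x - \<mu>) + (\<mu> - c)\<close>. The first moment around the mean vanishes, so only the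
    variance and the squared offset survive.\<close>
  have "has_bochner_integral lborel (\<lambda>x. normal_density \<mu> \<sigma> x * (x - \<mu>)\<^sup>2 +
      (2 * (\<mu> - c)) * (normal_density \<mu> \<sigma> x * (x - \<mu>)) + (\<mu> - c)\<^sup>2 * normal_density \<mu> \<sigma> x)
      (\<sigma>\<^sup>2 + (2 * (\<mu> - c)) * 0 + (\<mu> - c)\<^sup>2 * 1)"
    by (intro has_bochner_integral_add has_bochner_integral_mult_right 0 1 2)
  also have "(\<lambda>x. normal_density \<mu> \<sigma> x * (x - \<mu>)\<^sup>2 +
      (2 * (\<mu> - c)) * (normal_density \<mu> \<sigma> x * (x - \<mu>)) + (\<mu> - c)\<^sup>2 * normal_density \<mu> \<sigma> x) =
      (\<lambda>x. normal_density \<mu> \<sigma> x * (x - c)\<^sup>2)"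
    by (auto simp: power2_eq_square algebra_simps)
  finally have "has_bochner_integral lborel (\<lambda>x. normal_density \<mu> \<sigma> x * (x - c)\<^sup>2) (\<sigma>\<^sup>2 + (\<mu> - c)\<^sup>2)"
    by simp
  then show ?thesis
    by (subst nn_integral_eq_integral) (auto simp: has_bochner_integral_iff)
qed

lemma nn_integral_cn_density_sq:
  assumes "0 < s"
  shows "(\<integral>\<^sup>+ z. cn_density s (z - m) * (cmod (z - c))\<^sup>2 \<partial>lborel) = ennreal (s + (cmod (m - c))\<^sup>2)"
proof -
  let ?\<sigma> = "sqrt (s / 2)"
  have \<sigma>: "0 < ?\<sigma>" using assms by simp
  let ?f = "\<lambda>u. ennreal (normal_density (Re m) ?\<sigma> u)" and ?g = "\<lambda>v. ennreal (normal_density (Im m) ?\<sigma> v)"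
  let ?F = "\<lambda>u. ennreal (normal_density (Re m) ?\<sigma> u * (u - Re c)\<^sup>2)"
  let ?G = "\<lambda>v. ennreal (normal_density (Im m) ?\<sigma> v * (v - Im c)\<^sup>2)"
  \<comment> \<open>The squared modulus is a sum over the two coordinates. In each summand the other
    coordinate integrates to 1, and the two variances \<open>s / 2\<close> add up to
    \<open>s\<close>.\<close>
  have eq: "ennreal (cn_density s (Complex u v - m) * (cmod (Complex u v - c))\<^sup>2) =
      ?F u * ?g v + ?f u * ?G v" for u v
    using assms
    by (simp add: cn_density_Complex cmod_power2 ennreal_mult[symmetric] ennreal_plus[symmetric] algebra_simps
        del: ennreal_plus)
  have "(\<integral>\<^sup>+ z. cn_density s (z - m) * (cmod (z - c))\<^sup>2 \<partial>lborel) =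
      (\<integral>\<^sup>+ u. \<integral>\<^sup>+ v. ?F u * ?g v + ?f u * ?G v \<partial>lborel \<partial>lborel)"
    by (subst nn_integral_lborel_complex) (auto simp: eq)
  also have "\<dots> = (\<integral>\<^sup>+ u. ?F u + ?f u * ennreal (s / 2 + (Im m - Im c)\<^sup>2) \<partial>lborel)"
    using assms by (simp add: nn_integral_add nn_integral_cmult nn_integral_normal_density
        nn_integral_normal_density_sq[OF \<sigma>])
  also have "\<dots> = ennreal (s / 2 + (Re m - Re c)\<^sup>2) + ennreal (s / 2 + (Im m - Im c)\<^sup>2)"
    using assms by (simp add: nn_integral_add nn_integral_multc nn_integral_normal_density
        nn_integral_normal_density_sq[OF \<sigma>])
  also have "\<dots> = ennreal (s + (cmod (m - c))\<^sup>2)"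
    using assms by (simp add: ennreal_plus[symmetric] cmod_power2 del: ennreal_plus)
  finally show ?thesis .
qed

lemma complex_normal_eq: "complex_normal = density lborel (cn_density 1)"
proof (rule measure_eqI)
  let ?nd = "normal_density 0 (sqrt (1 / 2))"
  have pd: "density lborel ?nd \<Otimes>\<^sub>M density lborel ?nd =
      density (lborel \<Otimes>\<^sub>M lborel) (\<lambda>(u, v). ennreal (?nd u) * ennreal (?nd v))"
    by (rule pair_measure_density)
      (auto intro!: prob_space_imp_sigma_finite prob_space_normal_density lborel.sigma_finite_measure_axioms)
  fix A assume "A \<in> sets complex_normal"
  then have [measurable]: "A \<in> sets borel" by (simp add: complex_normal_def)
  have "emeasure complex_normal A =
      (\<integral>\<^sup>+ x. ennreal (?nd (fst x)) * ennreal (?nd (snd x)) * indicator A (Complex (fst x) (snd x))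
        \<partial>(lborel \<Otimes>\<^sub>M lborel))"
    unfolding complex_normal_def pd
    by (subst emeasure_distr, simp, simp, subst emeasure_density, measurable)
      (auto intro!: nn_integral_cong simp: split_def indicator_def space_pair_measure)
  also have "\<dots> = (\<integral>\<^sup>+ u. \<integral>\<^sup>+ v. ennreal (cn_density 1 (Complex u v)) * indicator A (Complex u v) \<partial>lborel \<partial>lborel)"
    using cn_density_Complex[of 1 _ _ 0]
    by (subst lborel.nn_integral_fst[symmetric]) (auto simp: ennreal_mult)
  also have "\<dots> = emeasure (density lborel (cn_density 1)) A"
    by (subst emeasure_density) (auto simp: nn_integral_lborel_complex)
  finally show "emeasure complex_normal A = emeasure (density lborel (cn_density 1)) A" .
qed (simp add: complex_normal_def)

text \<open>Bayes' rule: prior times channel equals marginal times posterior.\<close>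

lemma cn_density_bayes:
  fixes a :: real and v m y :: complex
  assumes "0 < s" "0 < t"
  defines "\<tau> \<equiv> a\<^sup>2 * s + t"
  shows "cn_density s (v - m) * cn_density t (y - a * v) =
    cn_density \<tau> (y - a * m) * cn_density (s * t / \<tau>) (v - (m + of_real (a * s / \<tau>) * (y - a * m)))"
proof -
  have \<tau>: "0 < \<tau>" using assms by (auto intro: add_nonneg_pos)
  \<comment> \<open>Completing the square in \<open>p\<close>. Since \<open>a\<close> is real, the
    complex identity is this one applied to real and to imaginary parts. The normalising constants
    agree because \<open>s * t = \<tau> * (s * t / \<tau>)\<close>.\<close>
  have square: "(p - q)\<^sup>2 / s + (r - a * p)\<^sup>2 / t =
     (r - a * q)\<^sup>2 / \<tau> + (p - (q + a * s / \<tau> * (r - a * q)))\<^sup>2 / (s * t / \<tau>)" for p q r :: real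
  proof -
    define P R where "P = p - q" and "R = r - a * q"
    have num: "\<tau> * (t * P\<^sup>2 + s * (R - a * P)\<^sup>2) = s * t * R\<^sup>2 + (\<tau> * P - a * s * R)\<^sup>2"
      unfolding \<tau>_def by (simp add: power2_eq_square algebra_simps)
    have "P\<^sup>2 / s + (R - a * P)\<^sup>2 / t = \<tau> * (t * P\<^sup>2 + s * (R - a * P)\<^sup>2) / (s * t * \<tau>)"
      using assms(1,2) \<tau> by (simp add: field_simps)
    also have "\<dots> = R\<^sup>2 / \<tau> + ((\<tau> * P - a * s * R) / \<tau>)\<^sup>2 / (s * t / \<tau>)"
      unfolding num using assms(1,2) \<tau> by (simp add: field_simps power2_eq_square)
    also have "(\<tau> * P - a * s * R) / \<tau> = P - a * s / \<tau> * R"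
      using \<tau> by (simp add: field_simps)
    finally show ?thesis
      by (simp add: P_def R_def algebra_simps)
  qed
  have "(cmod (v - m))\<^sup>2 / s + (cmod (y - a * v))\<^sup>2 / t = (cmod (y - a * m))\<^sup>2 / \<tau> +
     (cmod (v - (m + of_real (a * s / \<tau>) * (y - a * m))))\<^sup>2 / (s * t / \<tau>)"
    using square[of "Re v" "Re m" "Re y"] square[of "Im v" "Im m" "Im y"]
    by (simp add: cmod_power2 add_divide_distrib distrib_right del: of_real_divide of_real_mult)
  then show ?thesis
    using \<tau> assms(1,2) by (simp add: cn_density_def exp_add[symmetric] field_simps)
qed

section \<open>Gaussian densities on complex vectors of length \<open>n\<close>\<close>

definition lborel_vec :: "nat \<Rightarrow> (nat \<Rightarrow> complex) measure" where
  "lborel_vec n = (\<Pi>\<^sub>M i\<in>{..<n}. lborel)"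

definition sqnorm :: "nat \<Rightarrow> (nat \<Rightarrow> complex) \<Rightarrow> real" where
  "sqnorm n z = (\<Sum>i<n. (cmod (z i))\<^sup>2)"

definition cn_vec_density :: "nat \<Rightarrow> real \<Rightarrow> (nat \<Rightarrow> complex) \<Rightarrow> (nat \<Rightarrow> complex) \<Rightarrow> real" where
  "cn_vec_density n s m z = (\<Prod>i<n. cn_density s (z i - m i))"

lemma sets_lborel_vec [measurable_cong]: "sets (lborel_vec n) = sets (\<Pi>\<^sub>M i\<in>{..<n}. borel)"
  unfolding lborel_vec_def by (rule sets_PiM_cong) auto

lemma measurable_component_vec [measurable (raw)]:
  assumes "f \<in> M \<rightarrow>\<^sub>M lborel_vec n" "i < n"
  shows "(\<lambda>x. f x i) \<in> borel_measurable M"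
  using measurable_compose[OF assms(1), of "\<lambda>z. z i" borel] assms(2)
  by (simp add: measurable_cong_sets[OF sets_lborel_vec refl] measurable_component_singleton)

lemma sigma_finite_lborel_vec: "sigma_finite_measure (lborel_vec n)"
proof -
  interpret product_sigma_finite "\<lambda>_ :: nat. lborel :: complex measure" ..
  show ?thesis unfolding lborel_vec_def by (rule sigma_finite) simp
qed

lemma measurable_sqnorm [measurable]:
  assumes [measurable]: "\<And>i. i < n \<Longrightarrow> (\<lambda>x. f x i) \<in> borel_measurable M"
  shows "(\<lambda>x. sqnorm n (f x)) \<in> borel_measurable M"
  unfolding sqnorm_def by measurable

lemma measurable_cn_vec_density [measurable]:
  assumes [measurable]: "\<And>i. i < n \<Longrightarrow> (\<lambda>x. f x i) \<in> borel_measurable M"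
    "\<And>i. i < n \<Longrightarrow> (\<lambda>x. m x i) \<in> borel_measurable M"
  shows "(\<lambda>x. cn_vec_density n s (m x) (f x)) \<in> borel_measurable M"
  unfolding cn_vec_density_def by measurable

lemma cn_vec_density_pos: "0 < s \<Longrightarrow> 0 < cn_vec_density n s m z"
  unfolding cn_vec_density_def by (intro prod_pos) (simp add: cn_density_pos)

text \<open>The logarithm is affine in a squared distance, so the expectation of a log-likelihood
  ratio of such densities involves second moments only.\<close>

lemma ln_cn_vec_density:
  assumes "0 < s"
  shows "ln (cn_vec_density n s m z) = - (real n * ln (pi * s)) - sqnorm n (\<lambda>i. z i - m i) / s"
proof -
  have "ln (cn_density s x) = - ln (pi * s) - (cmod x)\<^sup>2 / s" for x
    using assms by (simp add: cn_density_def ln_div)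
  moreover have "cn_density s x > 0" for x using assms by (rule cn_density_pos)
  then have "cn_density s x \<noteq> 0" for x by (simp add: less_imp_neq[symmetric])
  ultimately show ?thesis
    unfolding cn_vec_density_def sqnorm_def
    by (simp add: ln_prod \<open>\<And>x. 0 < cn_density s x\<close> sum_subtractf sum_negf sum_divide_distrib)
qed

text \<open>The scalar rule in each coordinate. The offset \<open>x\<close>, later the codeword of
  the other user, is absorbed by passing from \<open>y\<close> to \<open>y - x\<close>.\<close>

lemma cn_vec_density_bayes:
  fixes a :: real and v m x y :: "nat \<Rightarrow> complex"
  assumes "0 < s" "0 < t"
  defines "\<tau> \<equiv> a\<^sup>2 * s + t"
  shows "cn_vec_density n s m v * cn_vec_density n t (\<lambda>i. x i + a * v i) y =
    cn_vec_density n \<tau> (\<lambda>i. x i + a * m i) y *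
    cn_vec_density n (s * t / \<tau>) (\<lambda>i. m i + of_real (a * s / \<tau>) * (y i - x i - a * m i)) v"
  unfolding cn_vec_density_def prod.distrib[symmetric]
  using cn_density_bayes[OF assms(1,2), where a = a, folded \<tau>_def]
  by (intro prod.cong refl) (simp add: diff_diff_eq[symmetric])

lemma prob_space_cn_density: "0 < s \<Longrightarrow> prob_space (density lborel (\<lambda>z. cn_density s (z - m)))"
  by (intro prob_spaceI) (simp add: emeasure_density nn_integral_cn_density)

text \<open>Both measures agree on boxes, where the integral of the product factors over the
  coordinates. Normalisation and coordinate marginals of the vector density then come from the
  theory of product measures.\<close>

lemma density_cn_vec_density:
  assumes "0 < s"
  shows "density (lborel_vec n) (cn_vec_density n s m) =
    (\<Pi>\<^sub>M i\<in>{..<n}. density lborel (\<lambda>z. cn_density s (z - m i)))"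
proof (rule product_sigma_finite.PiM_eqI)
  interpret L: product_sigma_finite "\<lambda>_ :: nat. lborel :: complex measure" ..
  show "product_sigma_finite (\<lambda>i. density lborel (\<lambda>z. ennreal (cn_density s (z - m i))))"
    unfolding product_sigma_finite_def using assms
    by (auto intro!: prob_space_imp_sigma_finite prob_space_cn_density)
  show "sets (density (lborel_vec n) (\<lambda>x. ennreal (cn_vec_density n s m x))) =
    sets (\<Pi>\<^sub>M i\<in>{..<n}. density lborel (\<lambda>z. ennreal (cn_density s (z - m i))))"
    unfolding sets_density sets_lborel_vec by (rule sets_PiM_cong) auto
  fix A assume A: "\<And>i. i \<in> {..<n} \<Longrightarrow> A i \<in> sets (density lborel (\<lambda>z. ennreal (cn_density s (z - m i))))"
  have [measurable]: "i < n \<Longrightarrow> A i \<in> sets borel" for i using A[of i] by simp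
  have A': "Pi\<^sub>E {..<n} A \<in> sets (lborel_vec n)"
    unfolding sets_lborel_vec by (rule sets_PiM_I_finite) auto
  have "emeasure (density (lborel_vec n) (cn_vec_density n s m)) (Pi\<^sub>E {..<n} A) =
      (\<integral>\<^sup>+ z. (\<Prod>i<n. ennreal (cn_density s (z i - m i)) * indicator (A i) (z i)) \<partial>lborel_vec n)"
  proof (subst emeasure_density)
    have "ennreal (cn_vec_density n s m z) * indicator (Pi\<^sub>E {..<n} A) z =
      (\<Prod>i<n. ennreal (cn_density s (z i - m i)) * indicator (A i) (z i))"
      if "z \<in> space (lborel_vec n)" for z
    proof -
      have "z \<in> Pi\<^sub>E {..<n} A \<longleftrightarrow> (\<forall>i<n. z i \<in> A i)"
        using that by (auto simp: lborel_vec_def space_PiM PiE_def)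
      then have "indicator (Pi\<^sub>E {..<n} A) z = (\<Prod>i<n. indicator (A i) (z i) :: ennreal)"
        by (auto simp: indicator_def prod_zero_iff)
      then show ?thesis
        using assms by (simp add: cn_vec_density_def prod.distrib prod_ennreal cn_density_pos less_imp_le)
    qed
    then show "(\<integral>\<^sup>+ z. ennreal (cn_vec_density n s m z) * indicator (Pi\<^sub>E {..<n} A) z \<partial>lborel_vec n) =
      (\<integral>\<^sup>+ z. (\<Prod>i<n. ennreal (cn_density s (z i - m i)) * indicator (A i) (z i)) \<partial>lborel_vec n)"
      by (rule nn_integral_cong)
  qed (use A' in auto)
  also have "\<dots> = (\<Prod>i<n. \<integral>\<^sup>+ x. ennreal (cn_density s (x - m i)) * indicator (A i) x \<partial>lborel)"
    unfolding lborel_vec_def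
    by (rule L.product_nn_integral_prod) auto
  also have "\<dots> = (\<Prod>i<n. emeasure (density lborel (\<lambda>z. ennreal (cn_density s (z - m i)))) (A i))"
    by (intro prod.cong refl, subst emeasure_density) auto
  finally show "emeasure (density (lborel_vec n) (cn_vec_density n s m)) (Pi\<^sub>E {..<n} A) =
      (\<Prod>i<n. emeasure (density lborel (\<lambda>z. ennreal (cn_density s (z - m i)))) (A i))" .
qed simp

lemma prob_space_cn_vec_density:
  assumes "0 < s"
  shows "prob_space (density (lborel_vec n) (cn_vec_density n s m))"
  unfolding density_cn_vec_density[OF assms]
  by (rule prob_space_PiM) (rule prob_space_cn_density[OF assms])

lemma nn_integral_cn_vec_density:
  assumes "0 < s"
  shows "(\<integral>\<^sup>+ z. cn_vec_density n s m z \<partial>lborel_vec n) = 1"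
  using prob_space.emeasure_space_1[OF prob_space_cn_vec_density[OF assms], of n m]
  by (simp add: emeasure_density cong: nn_integral_cong)

lemma has_bochner_integral_distr_iff:
  fixes f :: "'a \<Rightarrow> 'b::{banach, second_countable_topology}"
  assumes "f \<in> borel_measurable N" "g \<in> M \<rightarrow>\<^sub>M N"
  shows "has_bochner_integral (distr M N g) f x \<longleftrightarrow> has_bochner_integral M (\<lambda>x. f (g x)) x"
  using assms by (simp add: has_bochner_integral_iff integrable_distr_eq integral_distr)

text \<open>Linearity of expectation over the coordinate marginals. Integrability is part of the
  claim because these terms later enter the log-likelihood ratio with both signs.\<close>

lemma has_bochner_integral_sqnorm:
  assumes "0 < s"
  shows "has_bochner_integral (density (lborel_vec n) (cn_vec_density n s m))
    (\<lambda>z. sqnorm n (\<lambda>i. z i - c i)) (real n * s + sqnorm n (\<lambda>i. m i - c i))"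
proof -
  let ?M = "\<lambda>i. density lborel (\<lambda>z. ennreal (cn_density s (z - m i)))"
  have comp: "has_bochner_integral (PiM {..<n} ?M) (\<lambda>z. (cmod (z i - c i))\<^sup>2) (s + (cmod (m i - c i))\<^sup>2)"
    if "i < n" for i
  proof -
    have "has_bochner_integral (?M i) (\<lambda>z. (cmod (z - c i))\<^sup>2) (s + (cmod (m i - c i))\<^sup>2)"
      using assms
      by (intro has_bochner_integral_nn_integral)
        (auto simp: nn_integral_density ennreal_mult[symmetric] cn_density_pos less_imp_le
          nn_integral_cn_density_sq)
    moreover have "distr (PiM {..<n} ?M) (?M i) (\<lambda>z. z i) = ?M i"
      using that by (intro distr_PiM_component prob_space_cn_density assms) auto
    ultimately have "has_bochner_integral (distr (PiM {..<n} ?M) (?M i) (\<lambda>z. z i))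
        (\<lambda>z. (cmod (z - c i))\<^sup>2) (s + (cmod (m i - c i))\<^sup>2)"
      by simp
    then show ?thesis
      using that by (subst (asm) has_bochner_integral_distr_iff) auto
  qed
  have "has_bochner_integral (PiM {..<n} ?M) (\<lambda>z. \<Sum>i<n. (cmod (z i - c i))\<^sup>2)
    (\<Sum>i<n. s + (cmod (m i - c i))\<^sup>2)"
    by (rule has_bochner_integral_sum) (use comp in auto)
  then show ?thesis
    unfolding density_cn_vec_density[OF assms] sqnorm_def by (simp add: sum.distrib)
qed

section \<open>The law of the noise and its translates\<close>

lemma sets_noise [measurable_cong]: "sets (noise n) = sets (\<Pi>\<^sub>M i\<in>{..<n}. borel)"
  unfolding noise_def by (rule sets_PiM_cong) (auto simp: complex_normal_def)

lemma prob_space_noise: "prob_space (noise n)"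
  unfolding noise_def
  using prob_space_cn_density[of 1 0] by (intro prob_space_PiM) (simp add: complex_normal_eq)

text \<open>Translation invariance of Lebesgue measure in each coordinate. This turns the received
  vector in the error probabilities into a Gaussian density centred at the signal
  \<open>x\<close>.\<close>

lemma distr_noise_shift:
  "distr (noise n) (\<Pi>\<^sub>M i\<in>{..<n}. borel) (\<lambda>z. \<lambda>i\<in>{..<n}. x i + z i) =
    density (lborel_vec n) (cn_vec_density n 1 x)"
proof -
  have shift: "distr complex_normal borel (\<lambda>z. b + z) = density lborel (\<lambda>z. ennreal (cn_density 1 (z - b)))" for b
  proof -
    have "density lborel (\<lambda>z. ennreal (cn_density 1 (z - b))) =
      density (distr lborel borel (\<lambda>z. b + z)) (\<lambda>z. ennreal (cn_density 1 (z - b)))"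
      by (simp add: lborel_distr_plus)
    also have "\<dots> = distr (density lborel (\<lambda>z. ennreal (cn_density 1 z))) borel (\<lambda>z. b + z)"
      by (subst density_distr) auto
    finally show ?thesis by (simp add: complex_normal_eq)
  qed
  have prob: "prob_space complex_normal"
    using prob_space_cn_density[of 1 0] by (simp add: complex_normal_eq)
  have "distr (noise n) (\<Pi>\<^sub>M i\<in>{..<n}. borel) (\<lambda>z. \<lambda>i\<in>{..<n}. x i + z i) =
    (\<Pi>\<^sub>M i\<in>{..<n}. distr complex_normal borel (\<lambda>z. x i + z))" (is "?D = ?R")
  proof (rule product_sigma_finite.PiM_eqI)
    have prob': "prob_space (distr complex_normal borel (\<lambda>z. x i + z))" for i
      by (rule prob_space.prob_space_distr[OF prob]) (simp add: complex_normal_eq)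
    then show "product_sigma_finite (\<lambda>i. distr complex_normal borel (\<lambda>z. x i + z))"
      unfolding product_sigma_finite_def by (auto intro: prob_space_imp_sigma_finite)
    show "sets ?D = sets ?R"
      unfolding sets_distr by (rule sets_PiM_cong) auto
    fix A assume A: "\<And>i. i \<in> {..<n} \<Longrightarrow> A i \<in> sets (distr complex_normal borel (\<lambda>z. x i + z))"
    interpret product_sigma_finite "\<lambda>_ :: nat. complex_normal"
      unfolding product_sigma_finite_def by (auto intro: prob_space_imp_sigma_finite prob)
    have [measurable]: "i < n \<Longrightarrow> A i \<in> sets borel" for i using A[of i] by simp
    have sets: "Pi\<^sub>E {..<n} A \<in> sets (\<Pi>\<^sub>M i\<in>{..<n}. borel)"
      by (rule sets_PiM_I_finite) auto
    have "(\<lambda>z. \<lambda>i\<in>{..<n}. x i + z i) -` Pi\<^sub>E {..<n} A \<inter> space (noise n) =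
        (\<Pi>\<^sub>E i\<in>{..<n}. (\<lambda>z. x i + z) -` A i)"
      by (auto simp: noise_def space_PiM PiE_iff complex_normal_def extensional_def)
    then have "emeasure ?D (Pi\<^sub>E {..<n} A) = emeasure (noise n) (\<Pi>\<^sub>E i\<in>{..<n}. (\<lambda>z. x i + z) -` A i)"
      using sets by (subst emeasure_distr) auto
    also have "\<dots> = (\<Prod>i<n. emeasure complex_normal ((\<lambda>z. x i + z) -` A i))"
      unfolding noise_def
    proof (rule emeasure_PiM)
      show "(\<lambda>z. x i + z) -` A i \<in> sets complex_normal" if "i \<in> {..<n}" for i
        using that measurable_sets[of "\<lambda>z. x i + z" borel borel "A i"] by (simp add: complex_normal_def)
    qed simp
    also have "\<dots> = (\<Prod>i<n. emeasure (distr complex_normal borel (\<lambda>z. x i + z)) (A i))"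
      by (intro prod.cong refl, subst emeasure_distr) (auto simp: complex_normal_def)
    finally show "emeasure ?D (Pi\<^sub>E {..<n} A) =
      (\<Prod>i<n. emeasure (distr complex_normal borel (\<lambda>z. x i + z)) (A i))" .
  qed simp
  then show ?thesis by (simp add: shift density_cn_vec_density)
qed

subsection \<open>Change of measure\<close>

text \<open>A Fano-type inequality, with \<open>L\<close> the relative entropy of the two laws.
  Integrate \<open>ln x \<le> x - 1\<close> under the law of density \<open>p\<close> at half of the
  ratio \<open>q / p\<close> weighted by \<open>K\<close> on \<open>A\<close> and by 1 off
  \<open>A\<close>. The half is a normalisation: if the test law gives \<open>A\<close> mass
  \<open>1 / K\<close>, the weighted ratio has mean at most 2 and the right-hand side is 0.\<close>

lemma change_of_measure:
  fixes p q :: "'a \<Rightarrow> real" and K :: real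
  assumes [measurable]: "p \<in> borel_measurable N" "q \<in> borel_measurable N" "A \<in> sets N"
    and pos: "\<And>x. 0 < p x" "\<And>x. 0 < q x" "0 < K"
    and p1: "(\<integral>\<^sup>+ x. p x \<partial>N) = 1" and q1: "(\<integral>\<^sup>+ x. q x \<partial>N) = 1"
    and ratio: "has_bochner_integral (density N p) (\<lambda>x. ln (p x / q x)) L"
  shows "measure (density N p) A * ln K - L - ln 2 \<le> (K * measure (density N q) A - 1) / 2"
proof -
  let ?P = "density N p" and ?Q = "density N q"
  interpret P: prob_space ?P
    by (rule prob_spaceI) (simp add: emeasure_density p1 cong: nn_integral_cong)
  interpret Q: prob_space ?Q
    by (rule prob_spaceI) (simp add: emeasure_density q1 cong: nn_integral_cong)
  have indep: "has_bochner_integral ?P (\<lambda>x. indicator B x * (q x / p x)) (measure ?Q B)"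
    if [measurable]: "B \<in> sets N" for B
  proof (rule has_bochner_integral_nn_integral)
    have "(\<integral>\<^sup>+ x. ennreal (indicator B x * (q x / p x)) \<partial>?P) = (\<integral>\<^sup>+ x. q x * indicator B x \<partial>N)"
      using pos by (subst nn_integral_density)
        (auto intro!: nn_integral_cong simp: indicator_def ennreal_mult[symmetric] less_imp_le less_imp_neq[symmetric])
    also have "\<dots> = emeasure ?Q B"
      by (auto simp: emeasure_density indicator_def intro!: nn_integral_cong)
    finally show "(\<integral>\<^sup>+ x. ennreal (indicator B x * (q x / p x)) \<partial>?P) = ennreal (measure ?Q B)"
      by (simp add: Q.emeasure_eq_measure)
  qed (use pos in \<open>auto simp: less_imp_le\<close>)
  \<comment> \<open>Integrating \<open>q / p\<close> against the first law returns the second, so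
    the mean of this weighted ratio is \<open>K\<close> times the mass of \<open>A\<close> plus the
    mass of the complement, both under the second law. Positivity of \<open>p\<close> and
    \<open>q\<close> makes the logarithm of the ratio harmless.\<close>
  let ?f = "\<lambda>x. (if x \<in> A then K else 1) * (q x / p x)"
  have f: "has_bochner_integral ?P ?f (K * measure ?Q A + measure ?Q (space N - A))"
  proof -
    have "has_bochner_integral ?P (\<lambda>x. K * (indicator A x * (q x / p x)) +
        indicator (space N - A) x * (q x / p x)) (K * measure ?Q A + measure ?Q (space N - A))"
      by (intro has_bochner_integral_add has_bochner_integral_mult_right indep) auto
    also have "?this \<longleftrightarrow> ?thesis"
      by (rule has_bochner_integral_cong) (auto simp: indicator_def)
    finally show ?thesis .
  qed
  have const: "has_bochner_integral ?P (\<lambda>x. r) r" for r :: real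
    by (simp add: has_bochner_integral_iff P.prob_space[simplified])
  have f': "has_bochner_integral ?P (\<lambda>x. ?f x / 2 - 1) ((K * measure ?Q A + measure ?Q (space N - A)) / 2 - 1)"
    by (intro has_bochner_integral_diff has_bochner_integral_divide_zero f const)
  have l: "has_bochner_integral ?P (\<lambda>x. indicator A x * ln K - ln (p x / q x) - ln 2)
      (measure ?P A * ln K - L - ln 2)"
    by (intro has_bochner_integral_diff has_bochner_integral_mult_left ratio const
        has_bochner_integral_real_indicator) (auto simp: P.emeasure_eq_measure)
  have "measure ?P A * ln K - L - ln 2 \<le> (K * measure ?Q A + measure ?Q (space N - A)) / 2 - 1"
  proof -
    have "(\<integral>x. indicator A x * ln K - ln (p x / q x) - ln 2 \<partial>?P) \<le> (\<integral>x. ?f x / 2 - 1 \<partial>?P)"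
    proof (rule integral_mono)
      fix x
      have "0 < ?f x" using pos by simp
      then have "ln (?f x / 2) \<le> ?f x / 2 - 1" by (intro ln_le_minus_one) simp
      moreover have "ln (?f x / 2) = indicator A x * ln K - ln (p x / q x) - ln 2"
        using pos(1,2)[of x] pos(3) by (simp add: ln_div ln_mult indicator_def)
      ultimately show "indicator A x * ln K - ln (p x / q x) - ln 2 \<le> ?f x / 2 - 1" by simp
    qed (use l f' in \<open>simp_all add: has_bochner_integral_iff\<close>)
    then show ?thesis using l f' by (simp add: has_bochner_integral_iff)
  qed
  also have "measure ?Q (space N - A) \<le> 1" by simp
  finally show ?thesis by (simp add: field_simps)
qed

lemma distr_density_fst:
  assumes "sigma_finite_measure M2"
    and [measurable]: "f \<in> borel_measurable (M1 \<Otimes>\<^sub>M M2)" "f1 \<in> borel_measurable M1"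
    and eq: "\<And>x. x \<in> space M1 \<Longrightarrow> (\<integral>\<^sup>+ y. f (x, y) \<partial>M2) = f1 x"
  shows "distr (density (M1 \<Otimes>\<^sub>M M2) f) M1 fst = density M1 f1"
proof (rule measure_eqI)
  interpret sigma_finite_measure M2 by fact
  fix A assume "A \<in> sets (distr (density (M1 \<Otimes>\<^sub>M M2) f) M1 fst)"
  then have [measurable]: "A \<in> sets M1" by simp
  have "emeasure (distr (density (M1 \<Otimes>\<^sub>M M2) f) M1 fst) A =
      (\<integral>\<^sup>+ w. f w * indicator A (fst w) \<partial>(M1 \<Otimes>\<^sub>M M2))"
    by (subst emeasure_distr, simp, simp, subst emeasure_density)
      (auto intro!: nn_integral_cong simp: indicator_def)
  also have "\<dots> = (\<integral>\<^sup>+ x. (\<integral>\<^sup>+ y. f (x, y) \<partial>M2) * indicator A x \<partial>M1)"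
    by (subst nn_integral_fst[symmetric]) (auto intro!: nn_integral_cong simp: nn_integral_multc)
  also have "\<dots> = emeasure (density M1 f1) A"
    by (subst emeasure_density) (auto intro!: nn_integral_cong simp: eq)
  finally show "emeasure (distr (density (M1 \<Otimes>\<^sub>M M2) f) M1 fst) A = emeasure (density M1 f1) A" .
qed simp

lemma distr_density_snd:
  assumes "sigma_finite_measure M1" "sigma_finite_measure M2"
    and [measurable]: "f \<in> borel_measurable (M1 \<Otimes>\<^sub>M M2)" "f2 \<in> borel_measurable M2"
    and eq: "\<And>y. y \<in> space M2 \<Longrightarrow> (\<integral>\<^sup>+ x. f (x, y) \<partial>M1) = f2 y"
  shows "distr (density (M1 \<Otimes>\<^sub>M M2) f) M2 snd = density M2 f2"
proof (rule measure_eqI)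
  interpret pair_sigma_finite M1 M2 using assms(1,2) by (simp add: pair_sigma_finite_def)
  fix A assume "A \<in> sets (distr (density (M1 \<Otimes>\<^sub>M M2) f) M2 snd)"
  then have [measurable]: "A \<in> sets M2" by simp
  have "emeasure (distr (density (M1 \<Otimes>\<^sub>M M2) f) M2 snd) A =
      (\<integral>\<^sup>+ w. f w * indicator A (snd w) \<partial>(M1 \<Otimes>\<^sub>M M2))"
    by (subst emeasure_distr, simp, simp, subst emeasure_density)
      (auto intro!: nn_integral_cong simp: indicator_def)
  also have "\<dots> = (\<integral>\<^sup>+ y. (\<integral>\<^sup>+ x. f (x, y) \<partial>M1) * indicator A y \<partial>M2)"
    by (subst nn_integral_snd[symmetric]) (auto intro!: nn_integral_cong simp: nn_integral_multc)
  also have "\<dots> = emeasure (density M2 f2) A"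
    by (subst emeasure_density) (auto intro!: nn_integral_cong simp: eq)
  finally show "emeasure (distr (density (M1 \<Otimes>\<^sub>M M2) f) M2 snd) A = emeasure (density M2 f2) A" .
qed simp

text \<open>Applied to decoding regions: a decoder gives distinct outputs on disjoint
  events.\<close>

lemma (in finite_measure) sum_measure_fibres_le:
  assumes "finite I" "\<And>i. i \<in> I \<Longrightarrow> {x \<in> space M. P x \<and> f x = i} \<in> sets M"
    and "{x \<in> space M. P x} \<in> sets M"
  shows "(\<Sum>i\<in>I. measure M {x \<in> space M. P x \<and> f x = i}) \<le> measure M {x \<in> space M. P x}"
proof -
  have "(\<Sum>i\<in>I. measure M {x \<in> space M. P x \<and> f x = i}) =
      measure M (\<Union>i\<in>I. {x \<in> space M. P x \<and> f x = i})"
    using assms by (intro finite_measure_finite_Union[symmetric])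
      (auto simp: disjoint_family_on_def)
  also have "\<dots> \<le> measure M {x \<in> space M. P x}"
    using assms by (intro finite_measure_mono) auto
  finally show ?thesis .
qed

subsection \<open>The degraded pair of outputs\<close>

text \<open>The coupling of the outputs. \<open>v\<close> is the signal \<open>w1\<close> in unit
  noise, and \<open>y\<close> is \<open>w0 + a v\<close> in fresh noise of variance
  \<open>1 - a\<^sup>2\<close>, chosen so that the total noise in \<open>y\<close>, namely
  \<open>a\<^sup>2 + (1 - a\<^sup>2)\<close>, has variance 1 again.\<close>

definition joint_density ::
  "nat \<Rightarrow> real \<Rightarrow> (nat \<Rightarrow> complex) \<Rightarrow> (nat \<Rightarrow> complex) \<Rightarrow> (nat \<Rightarrow> complex) \<times> (nat \<Rightarrow> complex) \<Rightarrow> real"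
  where "joint_density n a w0 w1 = (\<lambda>(v, y).
    cn_vec_density n 1 w1 v * cn_vec_density n (1 - a\<^sup>2) (\<lambda>i. w0 i + of_real a * v i) y)"

text \<open>
  Here \<open>y\<close> is Gaussian, independently of both messages, and \<open>v\<close> given \<open>y\<close> has the posterior law of
  the degraded channel \<open>v \<mapsto> w0 + a v + noise\<close> for a Gaussian prior of variance \<open>1 + S\<close>.
  The second codeword does not occur.
\<close>

definition test_density ::
  "nat \<Rightarrow> real \<Rightarrow> real \<Rightarrow> real \<Rightarrow> (nat \<Rightarrow> complex) \<Rightarrow> (nat \<Rightarrow> complex) \<Rightarrow>
    (nat \<Rightarrow> complex) \<times> (nat \<Rightarrow> complex) \<Rightarrow> real"
  where "test_density n a S \<sigma> \<mu> w0 = (\<lambda>(v, y).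
    cn_vec_density n \<sigma> \<mu> y *
    cn_vec_density n ((1 + S) * (1 - a\<^sup>2) / (1 + a\<^sup>2 * S))
      (\<lambda>i. of_real (a * (1 + S) / (1 + a\<^sup>2 * S)) * (y i - w0 i)) v)"

lemma measurable_joint_density [measurable]:
  "joint_density n a w0 w1 \<in> borel_measurable (lborel_vec n \<Otimes>\<^sub>M lborel_vec n)"
  unfolding joint_density_def split_def by measurable

lemma measurable_test_density [measurable]:
  "test_density n a S \<sigma> \<mu> w0 \<in> borel_measurable (lborel_vec n \<Otimes>\<^sub>M lborel_vec n)"
  unfolding test_density_def split_def by measurable

context
  fixes a :: real
  assumes a: "a\<^sup>2 < 1"
begin

lemma distr_joint_density_fst:
  "distr (density (lborel_vec n \<Otimes>\<^sub>M lborel_vec n) (joint_density n a w0 w1)) (lborel_vec n) fst =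
    density (lborel_vec n) (cn_vec_density n 1 w1)"
proof (rule distr_density_fst[OF sigma_finite_lborel_vec])
  fix v
  show "(\<integral>\<^sup>+ y. ennreal (joint_density n a w0 w1 (v, y)) \<partial>lborel_vec n) = ennreal (cn_vec_density n 1 w1 v)"
    using a unfolding joint_density_def
    by (simp add: ennreal_mult cn_vec_density_pos less_imp_le nn_integral_cmult nn_integral_cn_vec_density)
qed auto

text \<open>Bayes' rule with \<open>s = 1\<close> and \<open>t = 1 - a\<^sup>2\<close> has marginal
  variance \<open>\<tau> = 1\<close>, and the posterior of \<open>v\<close> integrates to 1. Hence
  \<open>y\<close> has the law of the real channel output, and errors at the receiver can be
  evaluated inside the coupling.\<close>

lemma distr_joint_density_snd:
  "distr (density (lborel_vec n \<Otimes>\<^sub>M lborel_vec n) (joint_density n a w0 w1)) (lborel_vec n) snd =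
    density (lborel_vec n) (cn_vec_density n 1 (\<lambda>i. w0 i + of_real a * w1 i))"
proof (rule distr_density_snd[OF sigma_finite_lborel_vec sigma_finite_lborel_vec])
  fix y
  have "joint_density n a w0 w1 (v, y) = cn_vec_density n 1 (\<lambda>i. w0 i + of_real a * w1 i) y *
      cn_vec_density n (1 - a\<^sup>2) (\<lambda>i. w1 i + of_real a * (y i - w0 i - of_real a * w1 i)) v" for v
    using cn_vec_density_bayes[of 1 "1 - a\<^sup>2" n w1 v w0 a y] a
    by (simp add: joint_density_def)
  then show "(\<integral>\<^sup>+ v. ennreal (joint_density n a w0 w1 (v, y)) \<partial>lborel_vec n) =
      ennreal (cn_vec_density n 1 (\<lambda>i. w0 i + of_real a * w1 i) y)"
    using a
    by (simp add: ennreal_mult cn_vec_density_pos less_imp_le nn_integral_cmult nn_integral_cn_vec_density)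
qed auto

lemma distr_test_density_snd:
  assumes "0 \<le> S" "0 < \<sigma>"
  shows "distr (density (lborel_vec n \<Otimes>\<^sub>M lborel_vec n) (test_density n a S \<sigma> \<mu> w0)) (lborel_vec n) snd =
    density (lborel_vec n) (cn_vec_density n \<sigma> \<mu>)"
proof (rule distr_density_snd[OF sigma_finite_lborel_vec sigma_finite_lborel_vec])
  fix y
  have "0 < (1 + S) * (1 - a\<^sup>2) / (1 + a\<^sup>2 * S)"
    using a assms by (intro divide_pos_pos mult_pos_pos) (auto intro: add_pos_nonneg)
  then show "(\<integral>\<^sup>+ v. ennreal (test_density n a S \<sigma> \<mu> w0 (v, y)) \<partial>lborel_vec n) =
      ennreal (cn_vec_density n \<sigma> \<mu> y)"
    using assms unfolding test_density_def
    by (simp add: ennreal_mult cn_vec_density_pos less_imp_le nn_integral_cmult nn_integral_cn_vec_density)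
qed auto

lemma joint_density_pos: "0 < joint_density n a w0 w1 w"
  using a by (auto simp: joint_density_def split_def intro!: mult_pos_pos cn_vec_density_pos)

lemma test_density_pos: "0 \<le> S \<Longrightarrow> 0 < \<sigma> \<Longrightarrow> 0 < test_density n a S \<sigma> \<mu> w0 w"
  using a by (auto simp: test_density_def split_def
      intro!: mult_pos_pos cn_vec_density_pos divide_pos_pos add_pos_nonneg)

lemma prob_space_joint_density:
  "prob_space (density (lborel_vec n \<Otimes>\<^sub>M lborel_vec n) (joint_density n a w0 w1))"
  by (rule prob_space_distrD[of fst _ "lborel_vec n"])
    (simp_all add: distr_joint_density_fst prob_space_cn_vec_density)

lemma prob_space_test_density:
  assumes "0 \<le> S" "0 < \<sigma>"
  shows "prob_space (density (lborel_vec n \<Otimes>\<^sub>M lborel_vec n) (test_density n a S \<sigma> \<mu> w0))"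
  by (rule prob_space_distrD[of snd _ "lborel_vec n"])
    (simp_all add: distr_test_density_snd assms prob_space_cn_vec_density)

text \<open>The channel from \<open>v\<close> to \<open>y\<close> is common to both laws. Bayes'
  rule trades it and the posterior in the test law for the prior of \<open>v\<close>, of variance
  \<open>1 + S\<close>, and the marginal of \<open>y\<close> around \<open>w0\<close>, of variance
  \<open>1 + a\<^sup>2 * S\<close>. Four Gaussian densities remain, each in \<open>v\<close> alone
  or in \<open>y\<close> alone, so the expectation needs only the two marginals of the
  coupling.\<close>

lemma has_bochner_integral_ln_ratio:
  assumes "0 \<le> S" "0 < \<sigma>"
  shows "has_bochner_integral (density (lborel_vec n \<Otimes>\<^sub>M lborel_vec n) (joint_density n a w0 w1))
    (\<lambda>w. ln (joint_density n a w0 w1 w / test_density n a S \<sigma> \<mu> w0 w))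
    (real n * (ln (1 + S) + ln (\<sigma> / (1 + a\<^sup>2 * S)) - 1) + (real n + sqnorm n w1) / (1 + S)
      - (real n + a\<^sup>2 * sqnorm n w1) / (1 + a\<^sup>2 * S)
      + (real n + sqnorm n (\<lambda>i. w0 i + of_real a * w1 i - \<mu> i)) / \<sigma>)"
    (is "has_bochner_integral ?P ?f ?L")
proof -
  let ?y = "\<lambda>i. w0 i + of_real a * w1 i"
  define \<tau> where "\<tau> = 1 + a\<^sup>2 * S"
  have \<tau>: "0 < \<tau>" using assms by (auto simp: \<tau>_def intro: add_pos_nonneg)
  have f: "?f w = real n * (ln (1 + S) + ln (\<sigma> / \<tau>)) - sqnorm n (\<lambda>i. fst w i - w1 i)
      - sqnorm n (\<lambda>i. snd w i - w0 i) / \<tau> + sqnorm n (\<lambda>i. snd w i - \<mu> i) / \<sigma>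
      + sqnorm n (\<lambda>i. fst w i - 0) / (1 + S)" for w
  proof -
    obtain v y where w: "w = (v, y)" by (cases w)
    \<comment> \<open>Identifies \<open>\<tau>\<close> as the marginal variance in Bayes' rule for
      prior variance \<open>1 + S\<close> and channel noise \<open>1 - a\<^sup>2\<close>.\<close>
    have \<tau>': "\<tau> = a\<^sup>2 * (1 + S) + (1 - a\<^sup>2)" by (simp add: \<tau>_def algebra_simps)
    let ?G = "cn_vec_density n"
    define A B C where "A = ?G (1 - a\<^sup>2) (\<lambda>i. w0 i + of_real a * v i) y" and
      "B = ?G ((1 + S) * (1 - a\<^sup>2) / \<tau>) (\<lambda>i. of_real (a * (1 + S) / \<tau>) * (y i - w0 i)) v" and
      "C = ?G (1 + S) (\<lambda>i. 0) v"
    have pos: "0 < A" "0 < B" "0 < C" "0 < ?G \<tau> w0 y" "0 < ?G \<sigma> \<mu> y" "0 < ?G 1 w1 v"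
      using assms a \<tau> by (auto simp: A_def B_def C_def intro!: cn_vec_density_pos)
    \<comment> \<open>Prior \<open>C\<close> times channel \<open>A\<close> equals marginal times
      posterior \<open>B\<close>, with the codeword \<open>w0\<close> as known offset.\<close>
    have "C * A = ?G \<tau> w0 y * B"
      using cn_vec_density_bayes[of "1 + S" "1 - a\<^sup>2" n "\<lambda>i. 0" v w0 a y] assms a
      by (simp add: A_def B_def C_def \<tau>'[symmetric])
    then have "A / B = ?G \<tau> w0 y / C"
      using pos by (simp add: field_simps)
    then have "joint_density n a w0 w1 w / test_density n a S \<sigma> \<mu> w0 w =
        ?G 1 w1 v * ?G \<tau> w0 y / (?G \<sigma> \<mu> y * C)"
    proof -
      have "joint_density n a w0 w1 w = ?G 1 w1 v * A"
        by (simp add: w joint_density_def A_def)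
      moreover have "test_density n a S \<sigma> \<mu> w0 w = ?G \<sigma> \<mu> y * B"
        by (simp add: w test_density_def B_def \<tau>_def)
      moreover have "?G 1 w1 v * A / (?G \<sigma> \<mu> y * B) = ?G 1 w1 v / ?G \<sigma> \<mu> y * (A / B)"
        by simp
      ultimately show ?thesis
        by (simp add: \<open>A / B = ?G \<tau> w0 y / C\<close>)
    qed
    also have "ln \<dots> = ln (?G 1 w1 v) + ln (?G \<tau> w0 y) - (ln (?G \<sigma> \<mu> y) + ln C)"
      using pos by (simp add: ln_div ln_mult)
    also have "\<dots> = real n * (ln (1 + S) + ln (\<sigma> / \<tau>)) - sqnorm n (\<lambda>i. v i - w1 i)
      - sqnorm n (\<lambda>i. y i - w0 i) / \<tau> + sqnorm n (\<lambda>i. y i - \<mu> i) / \<sigma> + sqnorm n (\<lambda>i. v i - 0) / (1 + S)"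
    proof -
      have "ln (pi * \<tau>) = ln pi + ln \<tau>" "ln (pi * (1 + S)) = ln pi + ln (1 + S)"
        "ln (pi * \<sigma>) = ln pi + ln \<sigma>" "ln (\<sigma> / \<tau>) = ln \<sigma> - ln \<tau>"
        using assms \<tau> by (simp_all add: ln_mult ln_div)
      note lns = this
      show ?thesis
        using assms \<tau> unfolding C_def
        by (simp only: ln_cn_vec_density lns zero_less_one add_pos_nonneg mult_1_right div_by_1)
          (simp add: algebra_simps)
    qed
    finally show ?thesis by (simp add: w)
  qed
  have v: "has_bochner_integral ?P (\<lambda>w. sqnorm n (\<lambda>i. fst w i - c i)) (real n + sqnorm n (\<lambda>i. w1 i - c i))" for c
    using has_bochner_integral_sqnorm[OF zero_less_one, of n w1 c]
    unfolding distr_joint_density_fst[of n w0 w1, symmetric]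
    by (subst (asm) has_bochner_integral_distr_iff) auto
  have y: "has_bochner_integral ?P (\<lambda>w. sqnorm n (\<lambda>i. snd w i - c i)) (real n + sqnorm n (\<lambda>i. ?y i - c i))" for c
    using has_bochner_integral_sqnorm[OF zero_less_one, of n ?y c]
    unfolding distr_joint_density_snd[of n w0 w1, symmetric]
    by (subst (asm) has_bochner_integral_distr_iff) auto
  interpret P: prob_space ?P by (rule prob_space_joint_density)
  have const: "has_bochner_integral ?P (\<lambda>w. r) r" for r :: real
    by (simp add: has_bochner_integral_iff P.prob_space[simplified])
  have "has_bochner_integral ?P ?f (real n * (ln (1 + S) + ln (\<sigma> / \<tau>)) - (real n + sqnorm n (\<lambda>i. w1 i - w1 i))
      - (real n + sqnorm n (\<lambda>i. ?y i - w0 i)) / \<tau> + (real n + sqnorm n (\<lambda>i. ?y i - \<mu> i)) / \<sigma>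
      + (real n + sqnorm n (\<lambda>i. w1 i - 0)) / (1 + S))"
    unfolding f
    by (intro has_bochner_integral_add has_bochner_integral_diff has_bochner_integral_divide_zero const v y)
  moreover have "sqnorm n (\<lambda>i. of_real a * w1 i) = a\<^sup>2 * sqnorm n w1"
    by (simp add: sqnorm_def norm_mult power_mult_distrib sum_distrib_left)
  moreover have "sqnorm n (\<lambda>i. 0) = 0" by (simp add: sqnorm_def)
  ultimately show ?thesis
    by (simp add: \<tau>_def algebra_simps)
qed

text \<open>By the union bound both decoders are right with probability at least one minus the two
  errors. The change of measure is applied to that event; \<open>1 \<le> K\<close> makes
  \<open>ln K\<close> nonnegative, so this lower bound can be multiplied by it.\<close>

lemma message_pair_bound:
  fixes d0 d1 :: "(nat \<Rightarrow> complex) \<Rightarrow> nat"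
  assumes [measurable]: "d0 \<in> lborel_vec n \<rightarrow>\<^sub>M count_space UNIV" "d1 \<in> lborel_vec n \<rightarrow>\<^sub>M count_space UNIV"
    and "0 \<le> S" "0 < \<sigma>" "1 \<le> K"
  shows "(1 - measure (density (lborel_vec n) (cn_vec_density n 1 (\<lambda>i. w0 i + of_real a * w1 i)))
            {y \<in> space (lborel_vec n). d0 y \<noteq> m0}
          - measure (density (lborel_vec n) (cn_vec_density n 1 w1)) {v \<in> space (lborel_vec n). d1 v \<noteq> m1}) * ln K
     - (real n * (ln (1 + S) + ln (\<sigma> / (1 + a\<^sup>2 * S)) - 1) + (real n + sqnorm n w1) / (1 + S)
      - (real n + a\<^sup>2 * sqnorm n w1) / (1 + a\<^sup>2 * S)
      + (real n + sqnorm n (\<lambda>i. w0 i + of_real a * w1 i - \<mu> i)) / \<sigma>) - ln 2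
    \<le> (K * measure (density (lborel_vec n \<Otimes>\<^sub>M lborel_vec n) (test_density n a S \<sigma> \<mu> w0))
        {w \<in> space (lborel_vec n \<Otimes>\<^sub>M lborel_vec n). d0 (snd w) = m0 \<and> d1 (fst w) = m1} - 1) / 2"
    (is "(1 - ?e0 - ?e1) * _ - ?L - _ \<le> (K * measure ?Q ?A - 1) / 2")
proof -
  let ?N = "lborel_vec n \<Otimes>\<^sub>M lborel_vec n"
  let ?P = "density ?N (joint_density n a w0 w1)"
  interpret P: prob_space ?P by (rule prob_space_joint_density)
  interpret Q: prob_space ?Q by (rule prob_space_test_density) fact+
  have e0: "?e0 = P.prob {w \<in> space ?N. d0 (snd w) \<noteq> m0}"
    unfolding distr_joint_density_snd[of n w0 w1, symmetric]
    by (subst measure_distr) (auto intro!: arg_cong[where f = P.prob] simp: space_pair_measure)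
  have e1: "?e1 = P.prob {w \<in> space ?N. d1 (fst w) \<noteq> m1}"
    unfolding distr_joint_density_fst[of n w0 w1, symmetric]
    by (subst measure_distr) (auto intro!: arg_cong[where f = P.prob] simp: space_pair_measure)
  have "1 - P.prob ?A = P.prob (space ?P - ?A)"
    by (rule P.prob_compl[symmetric]) simp
  also have "\<dots> \<le> P.prob ({w \<in> space ?N. d0 (snd w) \<noteq> m0} \<union> {w \<in> space ?N. d1 (fst w) \<noteq> m1})"
    by (rule P.finite_measure_mono) auto
  also have "\<dots> \<le> ?e0 + ?e1"
    unfolding e0 e1 by (rule measure_Un_le) auto
  finally have "(1 - ?e0 - ?e1) * ln K \<le> P.prob ?A * ln K"
    using assms(5) by (intro mult_right_mono) auto
  moreover have "P.prob ?A * ln K - ?L - ln 2 \<le> (K * measure ?Q ?A - 1) / 2"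
  proof (rule change_of_measure)
    show "(\<integral>\<^sup>+ w. ennreal (joint_density n a w0 w1 w) \<partial>?N) = 1"
      using P.emeasure_space_1 by (simp add: emeasure_density cong: nn_integral_cong)
    show "(\<integral>\<^sup>+ w. ennreal (test_density n a S \<sigma> \<mu> w0 w) \<partial>?N) = 1"
      using Q.emeasure_space_1 by (simp add: emeasure_density cong: nn_integral_cong)
  qed (use assms in \<open>auto intro: joint_density_pos test_density_pos has_bochner_integral_ln_ratio\<close>)
  ultimately show ?thesis by linarith
qed

end

subsection \<open>The converse at finite block length\<close>

text \<open>Centring \<open>z\<close> removes the cross term with \<open>u\<close> and can only
  lower the second moment. It thus keeps the correlation of two codebooks, which need not have mean
  zero, out of the average power.\<close>

lemma sum_shifted_square:
  fixes u a :: real and z :: "'b \<Rightarrow> real"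
  assumes "finite B" "B \<noteq> {}"
  shows "(\<Sum>y\<in>B. (u + a * (z y - (\<Sum>y\<in>B. z y) / card B))\<^sup>2) \<le> card B * u\<^sup>2 + a\<^sup>2 * (\<Sum>y\<in>B. (z y)\<^sup>2)"
proof -
  define b where "b = (\<Sum>y\<in>B. z y) / card B"
  have b: "(\<Sum>y\<in>B. z y) = card B * b" using assms by (simp add: b_def)
  have "(\<Sum>y\<in>B. (u + a * (z y - b))\<^sup>2) =
      (\<Sum>y\<in>B. (u - a * b)\<^sup>2 + 2 * a * (u - a * b) * z y + a\<^sup>2 * (z y)\<^sup>2)"
    by (intro sum.cong refl) (simp add: power2_eq_square algebra_simps)
  also have "\<dots> = card B * (u - a * b)\<^sup>2 + 2 * a * (u - a * b) * (card B * b) + a\<^sup>2 * (\<Sum>y\<in>B. (z y)\<^sup>2)"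
    by (simp add: sum.distrib sum_distrib_left[symmetric] b)
  also have "\<dots> = card B * u\<^sup>2 + a\<^sup>2 * (\<Sum>y\<in>B. (z y)\<^sup>2) - card B * (a * b)\<^sup>2"
    by (simp add: power2_eq_square algebra_simps)
  also have "\<dots> \<le> card B * u\<^sup>2 + a\<^sup>2 * (\<Sum>y\<in>B. (z y)\<^sup>2)" by simp
  finally show ?thesis by (simp add: b_def)
qed

lemma sum_shifted_cmod_square:
  fixes u :: complex and a :: real and z :: "'b \<Rightarrow> complex"
  assumes "finite B" "B \<noteq> {}"
  shows "(\<Sum>y\<in>B. (cmod (u + of_real a * (z y - (\<Sum>y\<in>B. z y) / of_nat (card B))))\<^sup>2)
    \<le> card B * (cmod u)\<^sup>2 + a\<^sup>2 * (\<Sum>y\<in>B. (cmod (z y))\<^sup>2)"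
proof -
  have "(\<Sum>y\<in>B. (cmod (u + of_real a * (z y - (\<Sum>y\<in>B. z y) / of_nat (card B))))\<^sup>2) =
      (\<Sum>y\<in>B. (Re u + a * (Re (z y) - (\<Sum>y\<in>B. Re (z y)) / card B))\<^sup>2) +
      (\<Sum>y\<in>B. (Im u + a * (Im (z y) - (\<Sum>y\<in>B. Im (z y)) / card B))\<^sup>2)"
    by (simp add: cmod_power2 sum.distrib Re_divide_of_nat Im_divide_of_nat)
  also have "\<dots> \<le> (card B * (Re u)\<^sup>2 + a\<^sup>2 * (\<Sum>y\<in>B. (Re (z y))\<^sup>2)) +
      (card B * (Im u)\<^sup>2 + a\<^sup>2 * (\<Sum>y\<in>B. (Im (z y))\<^sup>2))"
    by (intro add_mono sum_shifted_square assms)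
  also have "\<dots> = card B * (cmod u)\<^sup>2 + a\<^sup>2 * (\<Sum>y\<in>B. (cmod (z y))\<^sup>2)"
    by (simp add: cmod_power2 sum.distrib algebra_simps)
  finally show ?thesis .
qed

lemma sum_sqnorm_superposition:
  fixes a :: real
  assumes "finite B" "B \<noteq> {}"
  shows "(\<Sum>y\<in>B. sqnorm n (\<lambda>i. u i + of_real a * (z y i - (\<Sum>y\<in>B. z y i) / of_nat (card B))))
    \<le> card B * sqnorm n u + a\<^sup>2 * (\<Sum>y\<in>B. sqnorm n (z y))"
proof -
  have "(\<Sum>y\<in>B. sqnorm n (\<lambda>i. u i + of_real a * (z y i - (\<Sum>y\<in>B. z y i) / of_nat (card B)))) =
     (\<Sum>i<n. \<Sum>y\<in>B. (cmod (u i + of_real a * (z y i - (\<Sum>y\<in>B. z y i) / of_nat (card B))))\<^sup>2)"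
    unfolding sqnorm_def by (rule sum.swap)
  also have "\<dots> \<le> (\<Sum>i<n. card B * (cmod (u i))\<^sup>2 + a\<^sup>2 * (\<Sum>y\<in>B. (cmod (z y i))\<^sup>2))"
    by (intro sum_mono sum_shifted_cmod_square assms)
  also have "\<dots> = card B * sqnorm n u + a\<^sup>2 * (\<Sum>y\<in>B. sqnorm n (z y))"
    unfolding sqnorm_def sum.swap[of _ "{..<n}" B] by (simp add: sum.distrib sum_distrib_left)
  finally show ?thesis .
qed

text \<open>Collects the quadratic part of the expected log-likelihood ratio. The last fraction is
  at most \<open>N\<close> because \<open>X \<le> N * (T + a\<^sup>2 * S)\<close>. Cross-multiplied,
  the difference of the two middle fractions has numerator
  \<open>(1 - a\<^sup>2) * (W - N * S)\<close>, which is where degradedness and the power constraint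
  meet. At full power, with equality in both bounds, everything cancels.\<close>

lemma power_terms_nonpos:
  fixes N W a S T X :: real
  assumes "0 \<le> N" "0 \<le> S" "0 \<le> T" "a\<^sup>2 < 1" "W \<le> N * S" "X \<le> N * T + a\<^sup>2 * W"
  shows "- N + (N + W) / (1 + S) - (N + a\<^sup>2 * W) / (1 + a\<^sup>2 * S) + (N + X) / (1 + T + a\<^sup>2 * S) \<le> 0"
proof -
  have pos: "0 < 1 + S" "0 < 1 + a\<^sup>2 * S" "0 < 1 + T + a\<^sup>2 * S"
    using assms by (auto intro: add_pos_nonneg)
  have "a\<^sup>2 * W \<le> a\<^sup>2 * (N * S)" using assms by (intro mult_left_mono) auto
  then have "N + X \<le> N * (1 + T + a\<^sup>2 * S)" using assms by (simp add: algebra_simps)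
  then have 1: "(N + X) / (1 + T + a\<^sup>2 * S) \<le> N" using pos by (simp add: divide_le_eq)
  have "(1 - a\<^sup>2) * (W - N * S) \<le> 0"
    using assms by (intro mult_nonneg_nonpos) auto
  then have "(N + W) * (1 + a\<^sup>2 * S) \<le> (N + a\<^sup>2 * W) * (1 + S)"
    by (simp add: algebra_simps)
  then have "(N + W) / (1 + S) \<le> (N + a\<^sup>2 * W) / (1 + a\<^sup>2 * S)"
    using pos by (simp add: frac_le_eq divide_le_eq le_divide_eq field_simps)
  with 1 show ?thesis by linarith
qed

definition block_error ::
  "nat \<Rightarrow> ((nat \<Rightarrow> complex) \<Rightarrow> nat) \<Rightarrow> nat \<Rightarrow> (nat \<Rightarrow> complex) \<Rightarrow> real" where
  "block_error n d m x = measure (density (lborel_vec n) (cn_vec_density n 1 x))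
    {y \<in> space (lborel_vec n). d y \<noteq> m}"

text \<open>For fixed \<open>m0\<close> the test law does not depend on \<open>m1\<close>, so the
  regions of \<open>d1\<close> are disjoint events and the inner sum is at most the probability of
  \<open>d0 y = m0\<close>. The law of \<open>y\<close> is the same for every \<open>m0\<close>, so
  these probabilities in turn belong to disjoint events of a single law.\<close>

lemma sum_test_density_le_1:
  fixes a :: real
  assumes "finite A0" "finite A1" "a\<^sup>2 < 1" "0 \<le> S" "0 < \<sigma>"
    and [measurable]: "d0 \<in> lborel_vec n \<rightarrow>\<^sub>M count_space UNIV" "d1 \<in> lborel_vec n \<rightarrow>\<^sub>M count_space UNIV"
  shows "(\<Sum>m0\<in>A0. \<Sum>m1\<in>A1.
    measure (density (lborel_vec n \<Otimes>\<^sub>M lborel_vec n) (test_density n a S \<sigma> \<mu> (w0 m0)))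
      {w \<in> space (lborel_vec n \<Otimes>\<^sub>M lborel_vec n). d0 (snd w) = m0 \<and> d1 (fst w) = m1}) \<le> 1"
proof -
  let ?N = "lborel_vec n \<Otimes>\<^sub>M lborel_vec n"
  let ?Y = "density (lborel_vec n) (cn_vec_density n \<sigma> \<mu>)"
  interpret Y: prob_space ?Y by (rule prob_space_cn_vec_density) fact
  have "(\<Sum>m1\<in>A1. measure (density ?N (test_density n a S \<sigma> \<mu> (w0 m0)))
      {w \<in> space ?N. d0 (snd w) = m0 \<and> d1 (fst w) = m1})
    \<le> Y.prob {y \<in> space (lborel_vec n). d0 y = m0}" for m0
  proof -
    let ?Q = "density ?N (test_density n a S \<sigma> \<mu> (w0 m0))"
    interpret Q: prob_space ?Q by (rule prob_space_test_density) fact+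
    have "(\<Sum>m1\<in>A1. Q.prob {w \<in> space ?Q. d0 (snd w) = m0 \<and> d1 (fst w) = m1})
        \<le> Q.prob {w \<in> space ?Q. d0 (snd w) = m0}"
      by (rule Q.sum_measure_fibres_le) (use assms in auto)
    also have "\<dots> = Y.prob {y \<in> space (lborel_vec n). d0 y = m0}"
      unfolding distr_test_density_snd[OF assms(3-5), of n \<mu> "w0 m0", symmetric]
      by (subst measure_distr) (auto intro!: arg_cong[where f = Q.prob] simp: space_pair_measure)
    finally show ?thesis by simp
  qed
  then have "(\<Sum>m0\<in>A0. \<Sum>m1\<in>A1. measure (density ?N (test_density n a S \<sigma> \<mu> (w0 m0)))
      {w \<in> space ?N. d0 (snd w) = m0 \<and> d1 (fst w) = m1})
    \<le> (\<Sum>m0\<in>A0. Y.prob {y \<in> space (lborel_vec n). d0 y = m0})"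
    by (rule sum_mono)
  also have "\<dots> \<le> Y.prob (space ?Y)"
    using Y.sum_measure_fibres_le[of A0 "\<lambda>_. True" d0] assms by simp
  also have "\<dots> = 1" by (rule Y.prob_space)
  finally show ?thesis .
qed

text \<open>Sums the bound for a message pair over all pairs, with \<open>K\<close> their number.
  The centre \<open>\<nu>\<close> permits a known offset in the first signal, such as a fixed
  interfering codeword.\<close>

lemma two_user_converse:
  fixes a :: real and w0 w1 :: "nat \<Rightarrow> nat \<Rightarrow> complex"
  assumes A: "finite A0" "A0 \<noteq> {}" "finite A1" "A1 \<noteq> {}"
    and a: "a\<^sup>2 < 1" and ST: "0 \<le> S" "0 \<le> T"
    and d: "d0 \<in> lborel_vec n \<rightarrow>\<^sub>M count_space UNIV" "d1 \<in> lborel_vec n \<rightarrow>\<^sub>M count_space UNIV"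
    and pow0: "\<And>m. m \<in> A0 \<Longrightarrow> sqnorm n (\<lambda>i. w0 m i - \<nu> i) \<le> n * T"
    and pow1: "\<And>m. m \<in> A1 \<Longrightarrow> sqnorm n (w1 m) \<le> n * S"
  shows "(1 - (\<Sum>m0\<in>A0. \<Sum>m1\<in>A1. block_error n d0 m0 (\<lambda>i. w0 m0 i + of_real a * w1 m1 i)) / (card A0 * card A1)
            - (\<Sum>m1\<in>A1. block_error n d1 m1 (w1 m1)) / card A1) * ln (card A0 * card A1)
    \<le> n * (ln (1 + S) + ln ((1 + T + a\<^sup>2 * S) / (1 + a\<^sup>2 * S))) + ln 2"
proof -
  let ?N = "lborel_vec n \<Otimes>\<^sub>M lborel_vec n"
  define k0 k1 K where "k0 = real (card A0)" and "k1 = real (card A1)" and "K = k0 * k1"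
  have "1 \<le> card A0" "1 \<le> card A1" using A by (auto simp: Suc_le_eq card_gt_0_iff)
  then have k: "1 \<le> k0" "1 \<le> k1" by (auto simp: k0_def k1_def)
  then have "1 * 1 \<le> k0 * k1" by (intro mult_mono) auto
  then have K: "1 \<le> K" by (simp add: K_def)
  \<comment> \<open>The variance of the output when both users spend their full power.\<close>
  define \<sigma> where "\<sigma> = 1 + T + a\<^sup>2 * S"
  have \<sigma>: "0 < \<sigma>" using ST by (auto simp: \<sigma>_def intro: add_pos_nonneg)
  \<comment> \<open>Centring the test output at the average of the second codebook makes the cross
    terms between the two users vanish in the sum over \<open>m1\<close>.\<close>
  define \<mu> where "\<mu> i = \<nu> i + of_real a * ((\<Sum>m\<in>A1. w1 m i) / of_nat (card A1))" for i
  define E0 where "E0 m0 m1 = block_error n d0 m0 (\<lambda>i. w0 m0 i + of_real a * w1 m1 i)" for m0 m1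
  define E1 where "E1 m1 = block_error n d1 m1 (w1 m1)" for m1
  define X where "X m0 m1 = sqnorm n (\<lambda>i. w0 m0 i + of_real a * w1 m1 i - \<mu> i)" for m0 m1
  define q where "q m0 m1 = measure (density ?N (test_density n a S \<sigma> \<mu> (w0 m0)))
      {w \<in> space ?N. d0 (snd w) = m0 \<and> d1 (fst w) = m1}" for m0 m1
  define C where "C = ln (1 + S) + ln (\<sigma> / (1 + a\<^sup>2 * S))"
  define L where "L m0 m1 = n * (C - 1) + (n + sqnorm n (w1 m1)) / (1 + S)
      - (n + a\<^sup>2 * sqnorm n (w1 m1)) / (1 + a\<^sup>2 * S) + (n + X m0 m1) / \<sigma>" for m0 m1
  define W where "W = k0 * (\<Sum>m\<in>A1. sqnorm n (w1 m))"
  define XX where "XX = (\<Sum>m0\<in>A0. \<Sum>m1\<in>A1. X m0 m1)"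
  have pair: "(1 - E0 m0 m1 - E1 m1) * ln K - L m0 m1 - ln 2 \<le> (K * q m0 m1 - 1) / 2" for m0 m1
    using message_pair_bound[OF a d ST(1) \<sigma> K, of "w0 m0" "w1 m1" m0 m1 \<mu>]
    unfolding E0_def E1_def L_def q_def block_error_def C_def X_def .
  have "(\<Sum>m0\<in>A0. \<Sum>m1\<in>A1. (1 - E0 m0 m1 - E1 m1) * ln K - L m0 m1 - ln 2)
      \<le> (\<Sum>m0\<in>A0. \<Sum>m1\<in>A1. (K * q m0 m1 - 1) / 2)"
    by (intro sum_mono pair)
  also have "\<dots> = (K * (\<Sum>m0\<in>A0. \<Sum>m1\<in>A1. q m0 m1) - K) / 2"
    by (simp add: sum_divide_distrib[symmetric] sum_subtractf sum_distrib_left[symmetric] K_def k0_def k1_def)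
  \<comment> \<open>With \<open>K\<close> the number of message pairs, total test probability at
    most 1 is exactly what makes the right-hand side nonpositive.\<close>
  also have "\<dots> \<le> 0"
    using sum_test_density_le_1[OF A(1,3) a ST(1) \<sigma> d, of \<mu> w0] K by (simp add: q_def)
  also have "(\<Sum>m0\<in>A0. \<Sum>m1\<in>A1. (1 - E0 m0 m1 - E1 m1) * ln K - L m0 m1 - ln 2) =
      (K - (\<Sum>m0\<in>A0. \<Sum>m1\<in>A1. E0 m0 m1) - k0 * (\<Sum>m1\<in>A1. E1 m1)) * ln K -
      (\<Sum>m0\<in>A0. \<Sum>m1\<in>A1. L m0 m1) - K * ln 2"
    by (simp add: sum_subtractf sum_distrib_right[symmetric] K_def k0_def k1_def)
  also have "(\<Sum>m0\<in>A0. \<Sum>m1\<in>A1. L m0 m1) = K * (n * C) + (- (K * n) + (K * n + W) / (1 + S)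
      - (K * n + a\<^sup>2 * W) / (1 + a\<^sup>2 * S) + (K * n + XX) / \<sigma>)"
    unfolding L_def W_def XX_def
    by (simp add: sum_subtractf sum.distrib sum_divide_distrib[symmetric] sum_distrib_left[symmetric]
        sum_distrib_right[symmetric] K_def k0_def k1_def algebra_simps)
  finally have sum: "(K - (\<Sum>m0\<in>A0. \<Sum>m1\<in>A1. E0 m0 m1) - k0 * (\<Sum>m1\<in>A1. E1 m1)) * ln K \<le>
      K * (n * C) + (- (K * n) + (K * n + W) / (1 + S)
      - (K * n + a\<^sup>2 * W) / (1 + a\<^sup>2 * S) + (K * n + XX) / \<sigma>) + K * ln 2"
    by linarith
  have "- (K * n) + (K * n + W) / (1 + S) - (K * n + a\<^sup>2 * W) / (1 + a\<^sup>2 * S) + (K * n + XX) / \<sigma> \<le> 0"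
    unfolding \<sigma>_def
  proof (rule power_terms_nonpos)
    have "(\<Sum>m\<in>A1. sqnorm n (w1 m)) \<le> (\<Sum>m\<in>A1. n * S)" by (intro sum_mono pow1)
    then have "W \<le> k0 * (\<Sum>m\<in>A1. n * S)" unfolding W_def using k by (intro mult_left_mono) auto
    then show "W \<le> K * n * S" by (simp add: K_def k1_def mult_ac)
    have "(\<Sum>m1\<in>A1. X m0 m1) \<le> k1 * (n * T) + a\<^sup>2 * (\<Sum>m\<in>A1. sqnorm n (w1 m))" if "m0 \<in> A0" for m0
    proof -
      have "(\<Sum>m1\<in>A1. X m0 m1) \<le> k1 * sqnorm n (\<lambda>i. w0 m0 i - \<nu> i) + a\<^sup>2 * (\<Sum>m\<in>A1. sqnorm n (w1 m))"
        using sum_sqnorm_superposition[OF A(3,4), of n "\<lambda>i. w0 m0 i - \<nu> i" a w1]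
        by (simp add: X_def \<mu>_def k1_def algebra_simps)
      also have "\<dots> \<le> k1 * (n * T) + a\<^sup>2 * (\<Sum>m\<in>A1. sqnorm n (w1 m))"
        using k pow0[OF that] by (intro add_mono mult_left_mono) auto
      finally show ?thesis .
    qed
    then have "XX \<le> (\<Sum>m0\<in>A0. k1 * (n * T) + a\<^sup>2 * (\<Sum>m\<in>A1. sqnorm n (w1 m)))"
      unfolding XX_def by (rule sum_mono)
    then show "XX \<le> K * n * T + a\<^sup>2 * W" by (simp add: K_def W_def k0_def algebra_simps)
  qed (use K ST a in auto)
  with sum have "(K - (\<Sum>m0\<in>A0. \<Sum>m1\<in>A1. E0 m0 m1) - k0 * (\<Sum>m1\<in>A1. E1 m1)) * ln K \<le> K * (n * C + ln 2)"
    by (simp add: algebra_simps)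
  moreover have "K - (\<Sum>m0\<in>A0. \<Sum>m1\<in>A1. E0 m0 m1) - k0 * (\<Sum>m1\<in>A1. E1 m1) =
      K * (1 - (\<Sum>m0\<in>A0. \<Sum>m1\<in>A1. E0 m0 m1) / K - (\<Sum>m1\<in>A1. E1 m1) / k1)"
    using K k by (simp add: K_def field_simps)
  ultimately have "K * ((1 - (\<Sum>m0\<in>A0. \<Sum>m1\<in>A1. E0 m0 m1) / K - (\<Sum>m1\<in>A1. E1 m1) / k1) * ln K) \<le> K * (n * C + ln 2)"
    by (simp add: mult.assoc)
  then have "(1 - (\<Sum>m0\<in>A0. \<Sum>m1\<in>A1. E0 m0 m1) / K - (\<Sum>m1\<in>A1. E1 m1) / k1) * ln K \<le> n * C + ln 2"
    using K by simp
  then show ?thesis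
    by (simp add: K_def k0_def k1_def E0_def E1_def C_def \<sigma>_def)
qed

subsection \<open>Error probabilities\<close>

lemma noise_error_eq:
  assumes "d \<in> lborel_vec n \<rightarrow>\<^sub>M count_space UNIV"
  shows "measure (noise n) {z \<in> space (noise n). d (\<lambda>i\<in>{..<n}. x i + z i) \<noteq> m} = block_error n d m x"
proof -
  let ?M = "\<Pi>\<^sub>M i\<in>{..<n}. (borel :: complex measure)"
  have space: "space (lborel_vec n) = space ?M"
    by (rule sets_eq_imp_space_eq[OF sets_lborel_vec])
  have [measurable]: "d \<in> ?M \<rightarrow>\<^sub>M count_space UNIV"
    using assms by (simp add: measurable_cong_sets[OF sets_lborel_vec refl])
  have shift: "(\<lambda>z. \<lambda>i\<in>{..<n}. x i + z i) \<in> noise n \<rightarrow>\<^sub>M ?M"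
    by measurable
  show ?thesis
    unfolding block_error_def space distr_noise_shift[symmetric]
    using measurable_space[OF shift]
    by (subst measure_distr[OF shift]) (auto intro!: arg_cong[where f = "measure (noise n)"])
qed

text \<open>Fubini over message and noise. The message space is arbitrary and \<open>f\<close>
  selects the wanted message, so that one statement covers the point-to-point channel
  (\<open>f\<close> the identity) and the interference channel (\<open>f\<close> a
  projection).\<close>

lemma emeasure_message_noise:
  assumes "d \<in> lborel_vec n \<rightarrow>\<^sub>M count_space UNIV"
    and [measurable]: "\<And>i. i < n \<Longrightarrow> (\<lambda>m. x m i) \<in> borel_measurable M" "f \<in> M \<rightarrow>\<^sub>M count_space UNIV"
  shows "emeasure (M \<Otimes>\<^sub>M noise n)
      {(m, z) \<in> space (M \<Otimes>\<^sub>M noise n). d (\<lambda>i\<in>{..<n}. x m i + z i) \<noteq> f m} =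
    (\<integral>\<^sup>+ m. block_error n d (f m) (x m) \<partial>M)" (is "emeasure _ ?A = _")
    and "(\<lambda>m. block_error n d (f m) (x m)) \<in> borel_measurable M"
proof -
  interpret noise: prob_space "noise n" by (rule prob_space_noise)
  let ?V = "\<Pi>\<^sub>M i\<in>{..<n}. (borel :: complex measure)"
  have [measurable]: "d \<in> ?V \<rightarrow>\<^sub>M count_space UNIV"
    using assms(1) by (simp add: measurable_cong_sets[OF sets_lborel_vec refl])
  have "(\<lambda>w. \<lambda>i\<in>{..<n}. x (fst w) i + snd w i) \<in> M \<Otimes>\<^sub>M noise n \<rightarrow>\<^sub>M ?V"
    by measurable
  then have [measurable]: "(\<lambda>w. d (\<lambda>i\<in>{..<n}. x (fst w) i + snd w i)) \<in> M \<Otimes>\<^sub>M noise n \<rightarrow>\<^sub>M count_space UNIV"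
    by (rule measurable_compose) fact
  have A [measurable]: "?A \<in> sets (M \<Otimes>\<^sub>M noise n)"
  \<comment> \<open>Written as a countable union over the decoder output \<open>k\<close>, the error
    event is visibly measurable.\<close>
  proof -
    have "?A = {w \<in> space (M \<Otimes>\<^sub>M noise n).
        \<exists>k. d (\<lambda>i\<in>{..<n}. x (fst w) i + snd w i) = k \<and> f (fst w) \<noteq> k}"
      by auto
    also have "\<dots> \<in> sets (M \<Otimes>\<^sub>M noise n)" by measurable
    finally show ?thesis .
  qed
  have "measure (noise n) (Pair m -` ?A) = block_error n d (f m) (x m)" if "m \<in> space M" for m
    using noise_error_eq[OF assms(1), of "x m" "f m"] that
    by (simp add: vimage_def space_pair_measure)
  note eq = this
  show "emeasure (M \<Otimes>\<^sub>M noise n) ?A = (\<integral>\<^sup>+ m. block_error n d (f m) (x m) \<partial>M)"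
    by (subst noise.emeasure_pair_measure_alt[OF A])
      (auto intro!: nn_integral_cong simp: noise.emeasure_eq_measure eq[symmetric])
  have "(\<lambda>m. measure (noise n) (Pair m -` ?A)) \<in> borel_measurable M"
    using noise.measurable_emeasure_Pair[OF A] unfolding measure_def by measurable
  then show "(\<lambda>m. block_error n d (f m) (x m)) \<in> borel_measurable M"
    by (subst (asm) measurable_cong[OF eq]) auto
qed

lemma nn_integral_uniform_count_measure:
  assumes "finite A" "\<And>x. x \<in> A \<Longrightarrow> 0 \<le> f x"
  shows "(\<integral>\<^sup>+ x. ennreal (f x) \<partial>uniform_count_measure A) = ennreal ((\<Sum>x\<in>A. f x) / card A)"
  using assms unfolding uniform_count_measure_def
  by (subst nn_integral_point_measure_finite)
    (auto simp: ennreal_mult[symmetric] sum_divide_distrib sum_ennreal[symmetric] simp del: sum_ennreal intro!: sum.cong)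

lemma finite_messages: "finite (messages n R)" "messages n R \<noteq> {}"
  by (auto simp: messages_def Suc_le_eq)

lemma decoders_measurable: "d \<in> decoders n R \<Longrightarrow> d \<in> lborel_vec n \<rightarrow>\<^sub>M count_space UNIV"
  unfolding decoders_def measurable_cong_sets[OF sets_lborel_vec refl]
  by (erule measurable_compose) simp

lemma block_error_nonneg: "0 \<le> block_error n d m x"
  by (simp add: block_error_def)

lemma ptp_error_eq:
  assumes "d \<in> decoders n R"
  shows "ptp_error g n R c d =
    (\<Sum>m\<in>messages n R. block_error n d m (\<lambda>i. g * c m i)) / card (messages n R)"
proof -
  have "emeasure (uniform_count_measure (messages n R) \<Otimes>\<^sub>M noise n)
      {(m, z) \<in> space (uniform_count_measure (messages n R) \<Otimes>\<^sub>M noise n).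
        d (\<lambda>i\<in>{..<n}. g * c m i + z i) \<noteq> m} =
    ennreal ((\<Sum>m\<in>messages n R. block_error n d m (\<lambda>i. g * c m i)) / card (messages n R))"
    by (subst emeasure_message_noise(1)[OF decoders_measurable[OF assms], where f = "\<lambda>m. m"])
      (auto simp: nn_integral_uniform_count_measure finite_messages block_error_nonneg
        measurable_def sets_uniform_count_measure
        space_uniform_count_measure)
  then show ?thesis
    by (simp add: ptp_error_def measure_def sum_nonneg block_error_nonneg)
qed

lemma two_cases: "(j :: 2) = 0 \<or> j = 1"
  using exhaust_2[of j] by auto

lemma UNIV_2_complement: "(UNIV :: 2 set) = {j, 1 - j}"
proof -
  have "x = j \<or> x = 1 - j" for x using two_cases[of j] two_cases[of x] by auto
  then show ?thesis by auto
qed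

lemma two_neq_complement: "(j :: 2) \<noteq> 1 - j"
  using two_cases[of j] by auto

text \<open>Puts the wanted user \<open>j\<close> first and the interferer \<open>i\<close> second,
  so that both receivers are handled at once. The product over the two users becomes an iterated
  average.\<close>

lemma ic_error_eq:
  fixes j :: 2
  defines "i \<equiv> 1 - j"
  assumes d: "d \<in> decoders n (R $ j)"
  shows "ic_error g n R c j d =
    (\<Sum>m\<in>messages n (R $ j). \<Sum>m'\<in>messages n (R $ i).
      block_error n d m (\<lambda>k. g $ j $ j * c j m k + g $ j $ i * c i m' k)) /
    (card (messages n (R $ j)) * card (messages n (R $ i)))"
proof -
  let ?U = "\<lambda>l. uniform_count_measure (messages n (R $ l))"
  let ?M = "\<Pi>\<^sub>M l\<in>UNIV. ?U l"
  let ?x = "\<lambda>a b k. g $ j $ j * c j a k + g $ j $ i * c i b k"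
  let ?A = "messages n (R $ j)" and ?B = "messages n (R $ i)"
  note d' = decoders_measurable[OF d]
  have sum: "g $ j $ 0 * c 0 (m 0) k + g $ j $ 1 * c 1 (m 1) k = ?x (m j) (m i) k" for m k
    using two_cases[of j] by (auto simp: i_def add.commute)
  have prob: "prob_space (?U l)" for l
    by (rule prob_space_uniform_count_measure) (rule finite_messages)+
  interpret product_sigma_finite ?U
    unfolding product_sigma_finite_def by (auto intro: prob_space_imp_sigma_finite prob)
  have any [measurable]: "f \<in> borel_measurable (?U l)" for l and f :: "nat \<Rightarrow> complex"
    by (simp add: measurable_cong_sets[OF sets_uniform_count_measure_count_space refl])
  have any' [measurable]: "(\<lambda>m. m) \<in> ?U l \<rightarrow>\<^sub>M count_space UNIV" for l
    by (simp add: measurable_cong_sets[OF sets_uniform_count_measure_count_space refl])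
  have comp [measurable]: "(\<lambda>m. c l (m l) k) \<in> borel_measurable ?M" for l k
    by (rule measurable_compose[OF measurable_component_singleton[of l UNIV ?U, OF UNIV_I] any[of _ l]])
  have comp' [measurable]: "(\<lambda>m. m j) \<in> ?M \<rightarrow>\<^sub>M count_space UNIV"
    by (rule measurable_compose[OF measurable_component_singleton[of j UNIV ?U, OF UNIV_I] any'[of j]])
  have meas: "(\<lambda>w. ennreal (block_error n d (fst w) (?x (fst w) (snd w)))) \<in> borel_measurable (?U j \<Otimes>\<^sub>M ?U i)"
    by (intro measurable_compose[OF emeasure_message_noise(2)[OF d'] measurable_ennreal]) measurable
  have "emeasure (?M \<Otimes>\<^sub>M noise n) {(m, z) \<in> space (?M \<Otimes>\<^sub>M noise n).
      d (\<lambda>k\<in>{..<n}. g $ j $ 0 * c 0 (m 0) k + g $ j $ 1 * c 1 (m 1) k + z k) \<noteq> m j} =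
    (\<integral>\<^sup>+ m. block_error n d (m j) (?x (m j) (m i)) \<partial>?M)"
    unfolding sum
    by (rule emeasure_message_noise(1)[OF d']) measurable
  also have "\<dots> = (\<integral>\<^sup>+ m. block_error n d (m j) (?x (m j) (m i)) \<partial>PiM {j, i} ?U)"
    by (simp only: UNIV_2_complement[of j, folded i_def])
  also have "\<dots> = (\<integral>\<^sup>+ w. block_error n d (fst w) (?x (fst w) (snd w)) \<partial>(?U j \<Otimes>\<^sub>M ?U i))"
    by (rule product_nn_integral_pair) (use meas two_neq_complement[of j] in \<open>auto simp: split_def i_def\<close>)
  also have "\<dots> = (\<integral>\<^sup>+ a. \<integral>\<^sup>+ b. block_error n d a (?x a b) \<partial>?U i \<partial>?U j)"
    by (subst sigma_finite_measure.nn_integral_fst[OF sigma_finite_measures meas, symmetric]) simp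
  also have "\<dots> = ennreal ((\<Sum>a\<in>?A. (\<Sum>b\<in>?B. block_error n d a (?x a b)) / card ?B) / card ?A)"
    by (simp add: nn_integral_uniform_count_measure finite_messages block_error_nonneg sum_nonneg)
  finally show ?thesis
    unfolding ic_error_def Let_def measure_def
    by (simp add: sum_nonneg block_error_nonneg sum_divide_distrib[symmetric] mult.commute)
qed

subsection \<open>Asymptotics\<close>

lemma card_messages_ge: "2 powr (n * R) \<le> card (messages n R)"
  unfolding messages_def using real_nat_ceiling_ge[of "2 powr (real n * R)"] by simp

lemma ln_card_messages_ge: "n * R * ln 2 \<le> ln (card (messages n R))"
proof -
  have "n * R * ln 2 = ln (2 powr (n * R))" by (simp add: ln_powr)
  also have "\<dots> \<le> ln (card (messages n R))"
    by (intro ln_mono card_messages_ge) (auto intro: less_le_trans[OF _ card_messages_ge])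
  finally show ?thesis .
qed

text \<open>Division by \<open>n\<close> makes \<open>ln 2\<close> disappear in the limit. Once
  \<open>e n < 1\<close>, the factor \<open>1 - e n\<close> is positive and \<open>l n\<close> may
  be replaced by its lower bound \<open>n * r\<close>.\<close>

lemma rate_le_of_converse:
  fixes r C :: real and e l :: "nat \<Rightarrow> real"
  assumes "e \<longlonglongrightarrow> 0" and l: "\<And>n. n * r \<le> l n" and bound: "\<And>n. (1 - e n) * l n \<le> n * C + ln 2"
  shows "r \<le> C"
proof (rule tendsto_le)
  show "(\<lambda>n. (1 - e n) * r) \<longlonglongrightarrow> r"
    using tendsto_mult[OF tendsto_diff[OF tendsto_const[of 1] assms(1)] tendsto_const[of r]] by simp
  show "(\<lambda>n. C + ln 2 / real n) \<longlonglongrightarrow> C"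
    using tendsto_add[OF tendsto_const[of C] lim_const_over_n[of "ln 2 :: real"]] by simp
  have "\<forall>\<^sub>F n in sequentially. e n < 1"
    using order_tendstoD(2)[OF assms(1), of 1] by simp
  then show "\<forall>\<^sub>F n in sequentially. (1 - e n) * r \<le> C + ln 2 / real n"
    using eventually_gt_at_top[of 0]
  proof eventually_elim
    case (elim n)
    have "n * ((1 - e n) * r) = (1 - e n) * (n * r)" by simp
    also have "\<dots> \<le> (1 - e n) * l n" using elim l by (intro mult_left_mono) auto
    also have "\<dots> \<le> n * (C + ln 2 / n)" using bound[of n] elim by (simp add: distrib_left)
    finally show ?case using elim by simp
  qed
qed simp

lemma sqnorm_code_le:
  assumes "is_code Q n R c" "m \<in> messages n R"
  shows "sqnorm n (\<lambda>i. h * c m i) \<le> n * ((cmod h)\<^sup>2 * Q)"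
\<comment> \<open>For \<open>n = 0\<close> the factor \<open>1 / real n\<close> is 0 and the power
  constraint carries no information, but the sum is empty.\<close>
proof (cases "n = 0")
  case False
  then have "(\<Sum>i<n. (cmod (c m i))\<^sup>2) \<le> n * Q"
    using assms by (auto simp: is_code_def field_simps)
  then have "(cmod h)\<^sup>2 * (\<Sum>i<n. (cmod (c m i))\<^sup>2) \<le> (cmod h)\<^sup>2 * (n * Q)"
    by (rule mult_left_mono) simp
  then show ?thesis
    by (simp add: sqnorm_def norm_mult power_mult_distrib sum_distrib_left mult_ac)
qed (simp add: sqnorm_def)

text \<open>Both error probabilities are nonnegative, so a vanishing mean forces each of them to
  vanish.\<close>

lemma achievable_ptp_codesE:
  assumes "achievable_ptp_codes Q g R"
  obtains c d where "\<And>j. ptp_capacity_achieving Q (R $ j) (c j)"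
    and "\<And>j n. d j n \<in> decoders n (R $ j)"
    and "\<And>j. (\<lambda>n. ic_error g n R (\<lambda>l. c l n) j (d j n)) \<longlonglongrightarrow> 0"
proof -
  from assms obtain c d where c: "\<And>j. ptp_capacity_achieving Q (R $ j) (c j)"
    and d: "\<And>j n. d j n \<in> decoders n (R $ j)"
    and lim: "(\<lambda>n. (1 / 2) * (ic_error g n R (\<lambda>l. c l n) 0 (d 0 n) +
      ic_error g n R (\<lambda>l. c l n) 1 (d 1 n))) \<longlonglongrightarrow> 0"
    unfolding achievable_ptp_codes_def by blast
  let ?e = "\<lambda>j n. ic_error g n R (\<lambda>l. c l n) j (d j n)"
  have nonneg: "0 \<le> ?e j n" for j n by (simp add: ic_error_def Let_def)
  have lim': "(\<lambda>n. ?e 0 n + ?e 1 n) \<longlonglongrightarrow> 0"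
  proof -
    have "(\<lambda>n. 2 * ((1 / 2) * (?e 0 n + ?e 1 n))) \<longlonglongrightarrow> 2 * 0"
      by (rule tendsto_mult_left[OF lim])
    then show ?thesis by (simp only: mult.assoc[symmetric]) simp
  qed
  have "?e j \<longlonglongrightarrow> 0" for j
  proof (rule tendsto_sandwich[OF _ _ tendsto_const lim'])
    show "\<forall>\<^sub>F n in sequentially. ?e j n \<le> ?e 0 n + ?e 1 n"
      using two_cases[of j] nonneg by (intro always_eventually allI) auto
  qed (simp add: nonneg)
  with c d show thesis by (rule that)
qed

section \<open>Bounds on achievable rates\<close>

lemma Cap_mult_ln_2: "Cap x * ln 2 = ln (1 + x)"
  by (simp add: Cap_def log_def)

text \<open>The property of being ptp-capacity-achieving enters here: the code of user
  \<open>i\<close> is decodable over the gain \<open>h\<close>, and the interference link with gain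
  \<open>a * h\<close> is a degraded version of that channel. The finite converse is applied with
  first signal \<open>g $ j $ j\<close> times the codeword of user \<open>j\<close>, second signal
  \<open>h\<close> times that of user \<open>i\<close>, and centre 0.\<close>

lemma sum_rate_degraded:
  fixes j :: 2 and a :: real
  defines "i \<equiv> 1 - j"
  assumes Q: "0 < Q" and ach: "achievable_ptp_codes Q g R"
    and h: "of_real a * h = g $ j $ i" and a: "a\<^sup>2 < 1"
    and Ri: "R $ i < Cap ((cmod h)\<^sup>2 * Q)"
  shows "R $ j + R $ i \<le> Cap ((cmod h)\<^sup>2 * Q) +
    Cap (received_power Q g j j / (1 + received_power Q g j i))"
proof -
  define S T I where "S = (cmod h)\<^sup>2 * Q" and "T = received_power Q g j j" and "I = received_power Q g j i"
  have nonneg: "0 \<le> S" "0 \<le> T" "0 \<le> I"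
    using Q by (auto simp: S_def T_def I_def received_power_def)
  have I: "a\<^sup>2 * S = I"
    by (simp add: I_def S_def received_power_def h[symmetric] norm_mult power_mult_distrib)
  obtain c d where c: "\<And>j. ptp_capacity_achieving Q (R $ j) (c j)"
    and d: "\<And>j n. d j n \<in> decoders n (R $ j)"
    and lim: "\<And>j. (\<lambda>n. ic_error g n R (\<lambda>l. c l n) j (d j n)) \<longlonglongrightarrow> 0"
    by (rule achievable_ptp_codesE[OF ach]) (rule that)
  have code: "is_code Q n (R $ l) (c l n)" for l n
    using c by (auto simp: ptp_capacity_achieving_def)
  have "achieves_over_ptp h (R $ i) (c i)"
    using c[of i] Ri by (auto simp: ptp_capacity_achieving_def ptp_capacity_def)
  then obtain d' where d': "\<And>n. d' n \<in> decoders n (R $ i)"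
    and lim': "(\<lambda>n. ptp_error h n (R $ i) (c i n) (d' n)) \<longlonglongrightarrow> 0"
    by (auto simp: achieves_over_ptp_def)
  define e where "e n = ic_error g n R (\<lambda>l. c l n) j (d j n) + ptp_error h n (R $ i) (c i n) (d' n)" for n
  let ?kj = "\<lambda>n. card (messages n (R $ j))" and ?ki = "\<lambda>n. card (messages n (R $ i))"
  have "(R $ j + R $ i) * ln 2 \<le> ln (1 + S) + ln ((1 + T + I) / (1 + I))"
  proof (rule rate_le_of_converse)
    show "e \<longlonglongrightarrow> 0" unfolding e_def using tendsto_add[OF lim lim'] by simp
    show "n * ((R $ j + R $ i) * ln 2) \<le> ln (?kj n * ?ki n)" for n
    proof -
      have "0 < ?kj n" "0 < ?ki n" by (auto simp: card_gt_0_iff finite_messages)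
      then have "ln (real (?kj n) * real (?ki n)) = ln (?kj n) + ln (?ki n)"
        by (intro ln_mult_pos) auto
      then show ?thesis
        using ln_card_messages_ge[of n "R $ j"] ln_card_messages_ge[of n "R $ i"]
        by (simp add: algebra_simps)
    qed
    show "(1 - e n) * ln (?kj n * ?ki n) \<le> n * (ln (1 + S) + ln ((1 + T + I) / (1 + I))) + ln 2" for n
    proof -
      have w: "g $ j $ j * c j n m k + of_real a * (h * c i n m' k) = g $ j $ j * c j n m k + g $ j $ i * c i n m' k"
        for m m' k
        by (simp add: h[symmetric])
      have e: "1 - e n = 1 - (\<Sum>m\<in>messages n (R $ j). \<Sum>m'\<in>messages n (R $ i).
          block_error n (d j n) m (\<lambda>k. g $ j $ j * c j n m k + of_real a * (h * c i n m' k))) / (?kj n * ?ki n)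
        - (\<Sum>m\<in>messages n (R $ i). block_error n (d' n) m (\<lambda>k. h * c i n m k)) / ?ki n"
        unfolding e_def ic_error_eq[OF d] ptp_error_eq[OF d'] i_def[symmetric] w by simp
      have "sqnorm n (\<lambda>k. g $ j $ j * c j n m k - 0) \<le> n * T" if "m \<in> messages n (R $ j)" for m
        using sqnorm_code_le[OF code that] by (simp add: T_def received_power_def)
      moreover have "sqnorm n (\<lambda>k. h * c i n m k) \<le> n * S" if "m \<in> messages n (R $ i)" for m
        using sqnorm_code_le[OF code that] by (simp add: S_def)
      ultimately show ?thesis
        using two_user_converse[OF finite_messages[of n "R $ j"] finite_messages[of n "R $ i"] a nonneg(1,2)
            decoders_measurable[OF d[of j n]] decoders_measurable[OF d'[of n]],
            where ?w0.0 = "\<lambda>m k. g $ j $ j * c j n m k" and ?w1.0 = "\<lambda>m k. h * c i n m k" and \<nu> = "\<lambda>_. 0"]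
        unfolding I e by simp
    qed
  qed
  also have "ln (1 + S) + ln ((1 + T + I) / (1 + I)) = (Cap S + Cap (T / (1 + I))) * ln 2"
  proof -
    have "(1 + T + I) / (1 + I) = 1 + T / (1 + I)" using nonneg by (simp add: field_simps)
    then show ?thesis by (simp add: distrib_right Cap_mult_ln_2)
  qed
  finally show ?thesis by (simp add: S_def T_def I_def)
qed

text \<open>For each fixed message \<open>m'\<close> of the interferer, its codeword is a known
  offset and becomes the centre \<open>\<nu>\<close>. The second user of the converse is made
  trivial: message set \<open>{0}\<close>, zero signal, \<open>a = 0\<close>, \<open>S = 0\<close>,
  and a constant decoder that never errs. Averaging over \<open>m'\<close> restores the error at
  receiver \<open>j\<close>.\<close>

lemma single_rate_le:
  fixes j :: 2
  assumes Q: "0 < Q" and ach: "achievable_ptp_codes Q g R"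
  shows "R $ j \<le> Cap (received_power Q g j j)"
proof -
  define i where "i = 1 - j"
  define T where "T = received_power Q g j j"
  have T: "0 \<le> T" using Q by (auto simp: T_def received_power_def)
  obtain c d where c: "\<And>j. ptp_capacity_achieving Q (R $ j) (c j)"
    and d: "\<And>j n. d j n \<in> decoders n (R $ j)"
    and lim: "\<And>j. (\<lambda>n. ic_error g n R (\<lambda>l. c l n) j (d j n)) \<longlonglongrightarrow> 0"
    by (rule achievable_ptp_codesE[OF ach]) (rule that)
  have code: "is_code Q n (R $ l) (c l n)" for l n
    using c by (auto simp: ptp_capacity_achieving_def)
  let ?e = "\<lambda>n. ic_error g n R (\<lambda>l. c l n) j (d j n)"
  have "R $ j * ln 2 \<le> ln (1 + T)"
  proof (rule rate_le_of_converse[OF lim[of j]])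
    show "n * (R $ j * ln 2) \<le> ln (card (messages n (R $ j)))" for n
      using ln_card_messages_ge[of n "R $ j"] by (simp add: mult.assoc)
    show "(1 - ?e n) * ln (card (messages n (R $ j))) \<le> n * ln (1 + T) + ln 2" for n
    proof -
      let ?A = "messages n (R $ j)" and ?B = "messages n (R $ i)"
      let ?w = "\<lambda>m m' k. g $ j $ j * c j n m k + g $ j $ i * c i n m' k"
      define kj ki where "kj = real (card ?A)" and "ki = real (card ?B)"
      have k: "0 < kj" "0 < ki" by (auto simp: kj_def ki_def card_gt_0_iff finite_messages)
      define E where "E m' = (\<Sum>m\<in>?A. block_error n (d j n) m (?w m m'))" for m'
      have e: "?e n = (\<Sum>m'\<in>?B. E m') / (kj * ki)"
        unfolding ic_error_eq[OF d] E_def kj_def ki_def i_def[symmetric] by (subst sum.swap) simp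
      have "(1 - E m' / kj) * ln kj \<le> n * ln (1 + T) + ln 2" for m'
      proof -
        have "block_error n (\<lambda>_. 0) 0 x = 0" for x by (simp add: block_error_def)
        then show ?thesis
          using two_user_converse[OF finite_messages[of n "R $ j"], where ?A1.0 = "{0}" and a = 0 and S = 0
              and T = T and ?d0.0 = "d j n" and ?d1.0 = "\<lambda>_. 0" and n = n
              and ?w0.0 = "\<lambda>m. ?w m m'" and ?w1.0 = "\<lambda>_ _. 0" and \<nu> = "\<lambda>k. g $ j $ i * c i n m' k"]
            sqnorm_code_le[OF code[of n j]] decoders_measurable[OF d[of j n]] T
          by (simp add: E_def kj_def sqnorm_def T_def received_power_def)
      qed
      then have "(\<Sum>m'\<in>?B. (1 - E m' / kj) * ln kj) \<le> (\<Sum>m'\<in>?B. n * ln (1 + T) + ln 2)"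
        by (rule sum_mono)
      also have "(\<Sum>m'\<in>?B. (1 - E m' / kj) * ln kj) = (ki - (\<Sum>m'\<in>?B. E m') / kj) * ln kj"
        by (simp add: ki_def sum_distrib_right[symmetric] sum_subtractf sum_divide_distrib)
      also have "ki - (\<Sum>m'\<in>?B. E m') / kj = ki * (1 - ?e n)"
        using k by (simp add: e field_simps)
      finally have "ki * ((1 - ?e n) * ln kj) \<le> ki * (n * ln (1 + T) + ln 2)"
        by (simp add: ki_def mult.assoc)
      then show ?thesis using k by (simp add: kj_def)
    qed
  qed
  then have "R $ j * ln 2 \<le> Cap T * ln 2" by (simp add: Cap_mult_ln_2)
  then show ?thesis by (simp add: T_def)
qed

section \<open>From the rate bounds to the region\<close>

lemma obtain_degrading_gain:
  fixes z :: complex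
  assumes "0 < Q" "(cmod z)\<^sup>2 * Q < S"
  obtains a :: real and h :: complex where "of_real a * h = z" "a\<^sup>2 < 1" "(cmod h)\<^sup>2 * Q = S"
proof (cases "z = 0")
  case True
  \<comment> \<open>Without interference \<open>a = 0\<close> works, and \<open>h\<close> may be any
    gain of received power \<open>S\<close>; the nonnegative real one is taken.\<close>
  then show thesis
    using assms that[of 0 "of_real (sqrt (S / Q))"] by simp
next
  case False
  \<comment> \<open>The square of \<open>a\<close> is the ratio of the interference power to the
    larger power \<open>S\<close>, hence below 1, and dividing \<open>z\<close> by \<open>a\<close>
    raises the received power to \<open>S\<close>.\<close>
  define a where "a = sqrt ((cmod z)\<^sup>2 * Q / S)"
  have P: "0 < (cmod z)\<^sup>2 * Q" using False assms by simp
  then have S: "0 < S" using assms by linarith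
  have a: "a\<^sup>2 = (cmod z)\<^sup>2 * Q / S" "a \<noteq> 0" using P S by (auto simp: a_def)
  show thesis
  proof (rule that[of a "z / of_real a"])
    show "a\<^sup>2 < 1" using assms S by (simp add: a)
    show "(cmod (z / of_real a))\<^sup>2 * Q = S"
      using P S False assms(1) by (simp add: norm_divide power_divide a)
  qed (use a in simp)
qed

text \<open>The degraded bound requires a capacity above \<open>R $ i\<close> and a power above that
  of the interference. A capacity exceeding the maximum by \<epsilon> meets both demands, and
  \<epsilon> is arbitrary.\<close>

lemma sum_rate_le_max:
  fixes j :: 2
  defines "i \<equiv> 1 - j"
  assumes Q: "0 < Q" and ach: "achievable_ptp_codes Q g R"
  shows "R $ j + R $ i \<le> max (R $ i) (Cap (received_power Q g j i)) +
    Cap (received_power Q g j j / (1 + received_power Q g j i))"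
proof (rule field_le_epsilon)
  fix \<epsilon> :: real
  assume "0 < \<epsilon>"
  let ?I = "received_power Q g j i"
  define r where "r = max (R $ i) (Cap ?I) + \<epsilon>"
  \<comment> \<open>The inverse of \<open>Cap\<close> at \<open>r\<close>.\<close>
  define S where "S = 2 powr r - 1"
  have S: "Cap S = r" by (simp add: S_def Cap_def)
  have I: "0 \<le> ?I" using Q by (simp add: received_power_def)
  have "1 + ?I = 2 powr Cap ?I" using I by (simp add: Cap_def)
  also have "\<dots> < 2 powr r" using \<open>0 < \<epsilon>\<close> by (simp add: r_def less_max_iff_disj)
  finally have "(cmod (g $ j $ i))\<^sup>2 * Q < S" by (simp add: S_def received_power_def)
  then obtain a :: real and h where ah: "of_real a * h = g $ j $ i" "a\<^sup>2 < 1" "(cmod h)\<^sup>2 * Q = S"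
    using obtain_degrading_gain[OF Q] by metis
  have "R $ i < Cap ((cmod h)\<^sup>2 * Q)" using \<open>0 < \<epsilon>\<close> by (simp add: ah S r_def)
  from sum_rate_degraded[OF Q ach ah(1)[unfolded i_def] ah(2) this[unfolded i_def]]
  show "R $ j + R $ i \<le> max (R $ i) (Cap ?I) + Cap (received_power Q g j j / (1 + ?I)) + \<epsilon>"
    by (simp add: i_def[symmetric] ah S r_def)
qed

lemma closed_receiver_region: "closed (receiver_region Q g j)"
  unfolding receiver_region_def Let_def
  by (intro closed_Collect_conj closed_Collect_all closed_Collect_disj closed_Collect_le continuous_intros)

text \<open>If \<open>R $ i\<close> attains the maximum in the sum bound, it cancels and leaves the
  bound for interference treated as noise. Otherwise \<open>R $ i\<close> is at most the capacity of
  the interference link, and the sum bound together with the single-rate bound is the multiple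
  access alternative.\<close>

lemma achievable_in_receiver_region:
  assumes Q: "0 < Q" and ach: "achievable_ptp_codes Q g R"
  shows "R \<in> receiver_region Q g j"
proof -
  let ?T = "received_power Q g j j" and ?I = "received_power Q g j (1 - j)"
  have nonneg: "0 \<le> ?T" "0 \<le> ?I" using Q by (auto simp: received_power_def)
  \<comment> \<open>Chain rule for the capacities:
    \<open>(1 + I) * (1 + T / (1 + I)) = 1 + T + I\<close>.\<close>
  have "(Cap ?I + Cap (?T / (1 + ?I))) * ln 2 = Cap (?T + ?I) * ln 2"
    using nonneg
    by (simp add: distrib_right Cap_mult_ln_2 ln_mult_pos[symmetric] add_pos_nonneg)
      (simp add: field_simps add_pos_nonneg add_nonneg_eq_0_iff)
  then have "Cap ?I + Cap (?T / (1 + ?I)) = Cap (?T + ?I)" by simp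
  moreover have "R $ 0 + R $ 1 = R $ j + R $ (1 - j)"
    using two_cases[of j] by auto
  moreover have "\<forall>l. 0 \<le> R $ l" using ach by (simp add: achievable_ptp_codes_def)
  ultimately show ?thesis
    using sum_rate_le_max[OF Q ach, of j] single_rate_le[OF Q ach, of j]
    unfolding receiver_region_def Let_def by (auto simp: max_def split: if_splits)
qed

theorem theorem2:
  fixes g :: "complex ^ 2 ^ 2" and Q :: real
  assumes "Q > 0"
  shows "capacity_region_ptp_codes Q g \<subseteq> receiver_region Q g 0 \<inter> receiver_region Q g 1"
  unfolding capacity_region_ptp_codes_def
  using achievable_in_receiver_region[OF assms]
  by (intro closure_minimal closed_Int closed_receiver_region) blast

end
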